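(* Let $S\subset\mathbb{R}^n$ be a semialgebraic set and let $I\subset\mathbb{R}[x]=\mathbb{R}[x_1,\dots,x_n]$ be an ideal with prime decomposition $I=I_1\cap\cdots\cap I_k$. Then the following are equivalent: (1) $\mathcal{I}(S\cap\mathcal{V}(I))=I$; (2) for every $t$ with $1\le t\le k$, $\dim^{\mathrm{top}}(S\cap\mathcal{V}(I_t))=\dim I_t$.
   Context: A semialgebraic set in $\mathbb{R}^n$ is a finite union of sets of the form $\bigcap_{j}\{x: g_{j}(x)*_{j}0\}$ with $g_j\in\mathbb{R}[x]$ and each $*_j$ one of $>,\ge,=$. For an ideal $J\subset\mathbb{R}[x]$, $\mathcal{V}(J)=\{x\in\mathbb{R}^n:p(x)=0\ \forall p\in J\}$; for $A\subset\mathbb{R}^n$, $\mathcal{I}(A)=\{p\in\mathbb{R}[x]:p|_A=0\}$. "Prime decomposition" means an irredundant expression of $I$ as an intersection of prime ideals $I_1,\dots,I_k$ of $\mathbb{R}[x]$. For a prime ideal $J$, $\dim J$ is the transcendence degree over $\mathbb{R}$ of the fraction field of $\mathbb{R}[x]/J$ (the Krull dimension of $\mathbb{R}[x]/J$), with $\dim\mathbb{R}[x]=-1$. $\dim^{\mathrm{top}}A$ of a semialgebraic set $A$ is its topological dimension, i.e. the maximal dimension of a manifold contained in it, with $\dim^{\mathrm{top}}\emptyset=-1$. *)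

theory Defs
  imports "HOL-Analysis.Analysis" "HOL-Library.Poly_Mapping"
begin

text \<open>Real polynomials in the variables x_i, i ranging over the finite index type 'n.
  A monomial is an exponent vector (finitely supported exponent map); a polynomial is a finitely supported
  map from monomials to real coefficients. Ring operations are those of poly_mapping.\<close>

type_synonym 'n rpoly = "('n \<Rightarrow>\<^sub>0 nat) \<Rightarrow>\<^sub>0 real"

definition peval :: "'n::finite rpoly \<Rightarrow> real^'n \<Rightarrow> real" where
  "peval p x = (\<Sum>\<mu>\<in>Poly_Mapping.keys p. Poly_Mapping.lookup p \<mu> * (\<Prod>i\<in>UNIV. (x $ i) ^ Poly_Mapping.lookup \<mu> i))"

definition is_ideal :: "'a::comm_ring_1 set \<Rightarrow> bool" where
  "is_ideal I \<longleftrightarrow> 0 \<in> I \<and> (\<forall>a\<in>I. \<forall>b\<in>I. a + b \<in> I) \<and> (\<forall>r. \<forall>a\<in>I. r * a \<in> I)"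

definition is_prime_ideal :: "'a::comm_ring_1 set \<Rightarrow> bool" where
  "is_prime_ideal P \<longleftrightarrow> is_ideal P \<and> P \<noteq> UNIV \<and> (\<forall>a b. a * b \<in> P \<longrightarrow> a \<in> P \<or> b \<in> P)"

text \<open>Prime decomposition: I is the irredundant intersection of the finitely many
  prime ideals in the set Ps (the empty intersection being the whole ring).\<close>

definition prime_decomposition :: "'a::comm_ring_1 set \<Rightarrow> 'a set set \<Rightarrow> bool" where
  "prime_decomposition I Ps \<longleftrightarrow> finite Ps \<and> (\<forall>P\<in>Ps. is_prime_ideal P) \<and> I = \<Inter> Ps
     \<and> (\<forall>P\<in>Ps. \<Inter> (Ps - {P}) \<noteq> I)"

definition krull_dim :: "'a::comm_ring_1 set \<Rightarrow> int" where
  "krull_dim J = (if J = UNIV then -1 else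
     int (GREATEST d. \<exists>Qs. length Qs = Suc d \<and> (\<forall>Q\<in>set Qs. is_prime_ideal Q)
            \<and> J \<subseteq> hd Qs \<and> sorted_wrt (\<subset>) Qs))"

definition zero_set :: "'n::finite rpoly set \<Rightarrow> (real^'n) set" where
  "zero_set J = {x. \<forall>p\<in>J. peval p x = 0}"

definition vanishing_ideal :: "(real^'n::finite) set \<Rightarrow> 'n rpoly set" where
  "vanishing_ideal A = {p. \<forall>x\<in>A. peval p x = 0}"

datatype sign_cond = Gt | Ge | Eq

fun holds_cond :: "sign_cond \<Rightarrow> real \<Rightarrow> bool" where
  "holds_cond Gt v = (v > 0)"
| "holds_cond Ge v = (v \<ge> 0)"
| "holds_cond Eq v = (v = 0)"

definition basic_set :: "('n::finite rpoly \<times> sign_cond) list \<Rightarrow> (real^'n) set" where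
  "basic_set cs = {x. \<forall>(g, c)\<in>set cs. holds_cond c (peval g x)}"

definition semialgebraic :: "(real^'n::finite) set \<Rightarrow> bool" where
  "semialgebraic S \<longleftrightarrow> (\<exists>L. S = \<Union> (basic_set ` set L))"

text \<open>Topological dimension: maximal dimension of a (topological) manifold contained in A.
  R^d is modelled as the subspace of nat \<Rightarrow> real (product topology) of functions vanishing
  from index d on.\<close>

definition euclid :: "nat \<Rightarrow> (nat \<Rightarrow> real) set" where
  "euclid d = {y. \<forall>i\<ge>d. y i = 0}"

definition is_manifold :: "nat \<Rightarrow> 'a::topological_space set \<Rightarrow> bool" where
  "is_manifold d M \<longleftrightarrow> (\<forall>x\<in>M. \<exists>U V. openin (top_of_set M) U \<and> x \<in> U
      \<and> openin (top_of_set (euclid d)) V \<and> U homeomorphic V)"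

definition dim_top :: "'a::topological_space set \<Rightarrow> int" where
  "dim_top A = (if A = {} then -1 else
     int (GREATEST d. \<exists>M. M \<subseteq> A \<and> M \<noteq> {} \<and> is_manifold d M))"

end

theory Submission
  imports Defs "HOL-Homology.Invariance_of_Domain"
begin

text \<open>
  For a prime ideal \<open>P\<close>, order the variables so that a maximal independent set \<open>F\<close> modulo \<open>P\<close> comes
  first; the minimal polynomials of the remaining variables, each over the previous ones, form a
  triangular system whose zero set coincides with that of \<open>P\<close> wherever the leading coefficients do
  not vanish. Where the partial derivatives do not vanish either, the projection to the
  \<open>F\<close>-coordinates is locally injective on the zero set, and it has continuous local sections.
  Injectivity and invariance of domain bound the dimension of a manifold by the number of
  independent variables modulo a generic prime of the manifold; sections produce a manifold of
  dimension \<open>card F\<close> near every generic real point.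

  The Krull dimension is compared with independent sets directly: a strict inclusion of primes
  loses an independent variable by pseudo-division, and conversely a prime with enough real points
  starts a chain of length \<open>card F\<close>, obtained by repeatedly slicing the real zero set with a
  hyperplane \<open>x\<^sub>i = c\<close> and taking a generic prime of the slice. Here a
  generic prime of a set \<open>U\<close> is an ideal that contains the vanishing ideal of \<open>U\<close> and is maximal
  among those avoiding the polynomials that are nonzero on a dense subset of \<open>U\<close>.

  If \<open>P\<close> is the vanishing ideal of the part of its zero set in \<open>S\<close>, splitting the sign conditions
  leaves a relatively open subset of the zero set inside \<open>S\<close> whose vanishing ideal is still \<open>P\<close>, and this subset contains generic points.
\<close>

hide_const (open) UnivPoly.coeff UnivPoly.monom Module.smult

section \<open>Prime ideals and polynomials modulo a prime ideal\<close>

lemma ideal_zero: "is_ideal Q \<Longrightarrow> 0 \<in> Q"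
  and ideal_add: "is_ideal Q \<Longrightarrow> a \<in> Q \<Longrightarrow> b \<in> Q \<Longrightarrow> a + b \<in> Q"
  and ideal_mult_left: "is_ideal Q \<Longrightarrow> a \<in> Q \<Longrightarrow> r * a \<in> Q"
  by (auto simp: is_ideal_def)

lemma ideal_mult_right: "is_ideal Q \<Longrightarrow> a \<in> Q \<Longrightarrow> a * r \<in> Q"
  by (metis ideal_mult_left mult.commute)

lemma ideal_minus: "is_ideal Q \<Longrightarrow> a \<in> Q \<Longrightarrow> b \<in> Q \<Longrightarrow> a - b \<in> Q"
  using ideal_add[of Q a "- 1 * b"] ideal_mult_left[of Q b "- 1"] by simp

lemma ideal_sum: "is_ideal Q \<Longrightarrow> (\<And>i. i \<in> A \<Longrightarrow> f i \<in> Q) \<Longrightarrow> sum f A \<in> Q"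
  by (induction A rule: infinite_finite_induct) (auto intro: ideal_zero ideal_add)

lemma prime_idealD:
  assumes "is_prime_ideal Q"
  shows "is_ideal Q" "a * b \<in> Q \<Longrightarrow> a \<in> Q \<or> b \<in> Q" "1 \<notin> Q"
proof -
  show "is_ideal Q" "a * b \<in> Q \<Longrightarrow> a \<in> Q \<or> b \<in> Q"
    using assms by (auto simp: is_prime_ideal_def)
  show "1 \<notin> Q"
  proof
    assume "1 \<in> Q"
    then have "r \<in> Q" for r
      using \<open>is_ideal Q\<close> ideal_mult_left[of Q 1 r] by simp
    then show False
      using assms by (auto simp: is_prime_ideal_def)
  qed
qed

lemma prime_ideal_power: "is_prime_ideal Q \<Longrightarrow> a ^ N \<in> Q \<Longrightarrow> a \<in> Q"
  using prime_idealD(2,3)[of Q] by (induction N) auto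

text \<open>If no \<open>J x\<close> lay in \<open>P\<close>, choosing from each an element outside
  \<open>P\<close> and multiplying would give an element of the intersection, yet a product of
  elements outside a prime stays outside.\<close>

lemma prime_ideal_Inter_subset:
  assumes "is_prime_ideal P" "finite A" "\<And>x. x \<in> A \<Longrightarrow> is_ideal (J x)" "(\<Inter>x\<in>A. J x) \<subseteq> P"
  shows "\<exists>x\<in>A. J x \<subseteq> P"
proof (rule ccontr)
  assume "\<not> ?thesis"
  then have "\<forall>x\<in>A. \<exists>q. q \<in> J x \<and> q \<notin> P"
    by blast
  from bchoice[OF this] obtain q where q: "\<And>x. x \<in> A \<Longrightarrow> q x \<in> J x \<and> q x \<notin> P"
    by blast
  have "prod q A \<in> J x" if "x \<in> A" for x
    using that assms(2,3) q by (metis ideal_mult_right prod.remove)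
  then have "prod q A \<in> P"
    using assms(4) by blast
  moreover have "prod q B \<notin> P" if "finite B" "B \<subseteq> A" for B
    using that
  proof (induction B)
    case empty
    show ?case using prime_idealD(3)[OF assms(1)] by simp
  next
    case (insert b B)
    then show ?case
      using prime_idealD(2)[OF assms(1)] q by auto
  qed
  ultimately show False
    using assms(2) by blast
qed

section \<open>Subrings and pseudo-division\<close>

definition subring_set :: "'a::comm_ring_1 set \<Rightarrow> bool" where
  "subring_set A \<longleftrightarrow> 0 \<in> A \<and> 1 \<in> A \<and> (\<forall>a\<in>A. \<forall>b\<in>A. a + b \<in> A \<and> a - b \<in> A \<and> a * b \<in> A)"

text \<open>The subring varies during inductions over the variables, so polynomials over it are
  polynomials over the whole ring singled out by a predicate.\<close>

definition coeffs_in :: "'a::comm_ring_1 set \<Rightarrow> 'a poly \<Rightarrow> bool" where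
  "coeffs_in A F \<longleftrightarrow> (\<forall>i. coeff F i \<in> A)"

lemma subring_sum: "subring_set A \<Longrightarrow> (\<And>i. i \<in> S \<Longrightarrow> f i \<in> A) \<Longrightarrow> sum f S \<in> A"
  by (induction S rule: infinite_finite_induct) (auto simp: subring_set_def)

lemma subring_power: "subring_set A \<Longrightarrow> a \<in> A \<Longrightarrow> a ^ n \<in> A"
  by (induction n) (auto simp: subring_set_def)

lemma coeffs_in_add: "subring_set A \<Longrightarrow> coeffs_in A F \<Longrightarrow> coeffs_in A H \<Longrightarrow> coeffs_in A (F + H)"
  and coeffs_in_diff: "subring_set A \<Longrightarrow> coeffs_in A F \<Longrightarrow> coeffs_in A H \<Longrightarrow> coeffs_in A (F - H)"
  and coeffs_in_smult: "subring_set A \<Longrightarrow> a \<in> A \<Longrightarrow> coeffs_in A F \<Longrightarrow> coeffs_in A (smult a F)"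
  and coeffs_in_monom: "subring_set A \<Longrightarrow> a \<in> A \<Longrightarrow> coeffs_in A (monom a n)"
  and coeffs_in_0: "subring_set A \<Longrightarrow> coeffs_in A 0"
  by (auto simp: coeffs_in_def subring_set_def)

lemma coeffs_in_mult: "subring_set A \<Longrightarrow> coeffs_in A F \<Longrightarrow> coeffs_in A H \<Longrightarrow> coeffs_in A (F * H)"
  unfolding coeffs_in_def coeff_mult
  by (auto intro!: subring_sum simp: subring_set_def)

lemma of_nat_in_subring: "subring_set A \<Longrightarrow> of_nat n \<in> A"
  by (induction n) (auto simp: subring_set_def)

text \<open>The library derivative \<open>pderiv\<close> is restricted to coefficient types without zero divisors,
  which multivariate polynomials over an unordered index type are not known to be.\<close>

definition formal_deriv :: "'a::comm_ring_1 poly \<Rightarrow> 'a poly" where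
  "formal_deriv F = (\<Sum>i<degree F. monom (of_nat (Suc i) * coeff F (Suc i)) i)"

lemma coeff_formal_deriv: "coeff (formal_deriv F) i = of_nat (Suc i) * coeff F (Suc i)"
proof -
  have "coeff (formal_deriv F) i = (if i < degree F then of_nat (Suc i) * coeff F (Suc i) else 0)"
    by (simp add: formal_deriv_def coeff_sum sum.delta del: of_nat_Suc)
  then show ?thesis by (simp add: coeff_eq_0)
qed

lemma coeffs_in_formal_deriv: "subring_set A \<Longrightarrow> coeffs_in A F \<Longrightarrow> coeffs_in A (formal_deriv F)"
  using of_nat_in_subring[of A] unfolding coeffs_in_def coeff_formal_deriv
  by (metis subring_set_def)

lemma coeffs_in_poly: "subring_set A \<Longrightarrow> coeffs_in A F \<Longrightarrow> t \<in> A \<Longrightarrow> poly F t \<in> A"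
  unfolding poly_altdef coeffs_in_def
  using subring_power[of A t] by (auto intro!: subring_sum simp: subring_set_def)

lemma coeffs_in_mono: "A \<subseteq> B \<Longrightarrow> coeffs_in A F \<Longrightarrow> coeffs_in B F"
  by (auto simp: coeffs_in_def)

lemma degree_diff_lead_monom:
  assumes "degree P > 0"
  shows "degree (P - monom (lead_coeff P) (degree P)) < degree P"
proof -
  have "coeff (P - monom (lead_coeff P) (degree P)) i = 0" if "i > degree P - 1" for i
    using that assms by (cases "i = degree P") (auto simp: coeff_eq_0)
  then have "degree (P - monom (lead_coeff P) (degree P)) \<le> degree P - 1"
    by (meson degree_le)
  with assms show ?thesis by linarith
qed

text \<open>Each cancellation first multiplies \<open>P\<close> by the leading coefficient of
  \<open>F\<close>, so nothing is divided and all coefficients stay in \<open>A\<close>. The degree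
  bound on \<open>B\<close> serves the descent in \<open>descend_algebraic\<close>.\<close>

lemma pseudo_division_over:
  assumes A: "subring_set A" and F: "coeffs_in A F" "degree F > 0" and "coeffs_in A P"
  shows "\<exists>N B R. coeffs_in A B \<and> coeffs_in A R \<and> smult (lead_coeff F ^ N) P = F * B + R
    \<and> degree R < degree F \<and> degree B \<le> degree P - degree F"
  using assms(4)
proof (induction "degree P" arbitrary: P rule: less_induct)
  case less
  define c where "c = lead_coeff F"
  have cA: "c \<in> A" using F(1) by (auto simp: c_def coeffs_in_def)
  show ?case
  proof (cases "degree P < degree F")
    case True
    then show ?thesis
      using less.prems coeffs_in_0[OF A]
      by (intro exI[of _ 0] exI[of _ "0::'a poly"] exI[of _ P]) auto
  next
    case False
    define X where "X = monom (lead_coeff P) (degree P - degree F)"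
    define P' where "P' = smult c P - F * X"
    have X: "coeffs_in A X"
      unfolding X_def using less.prems by (intro coeffs_in_monom[OF A]) (auto simp: coeffs_in_def)
    have P': "coeffs_in A P'"
      unfolding P'_def using X F(1) less.prems cA A
      by (intro coeffs_in_diff coeffs_in_smult coeffs_in_mult)
    have "coeff P' i = 0" if "i > degree P - 1" for i
    proof (cases "i = degree P")
      case True
      then show ?thesis
        using False by (simp add: P'_def X_def c_def mult.commute[of F] coeff_monom_mult)
    next
      case False
      then have "i > degree P" using that by linarith
      then show ?thesis
        using \<open>\<not> degree P < degree F\<close>
        by (simp add: P'_def X_def mult.commute[of F] coeff_monom_mult coeff_eq_0)
    qed
    then have dP': "degree P' \<le> degree P - 1"
      by (meson degree_le)
    then have "degree P' < degree P"
      using False F(2) by linarith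
    from less.hyps[OF this P'] obtain N B R where IH: "coeffs_in A B" "coeffs_in A R"
      "smult (c ^ N) P' = F * B + R" "degree R < degree F" "degree B \<le> degree P' - degree F"
      unfolding c_def by blast
    have "smult (c ^ Suc N) P = smult (c ^ N) (P' + F * X)"
      by (simp add: P'_def mult.commute)
    also have "\<dots> = F * (B + smult (c ^ N) X) + R"
      using IH(3) by (simp add: smult_add_right algebra_simps)
    finally have eq: "smult (c ^ Suc N) P = F * (B + smult (c ^ N) X) + R" .
    have "degree (smult (c ^ N) X) \<le> degree P - degree F"
      by (metis X_def degree_monom_le degree_smult_le order_trans)
    moreover have "degree B \<le> degree P - degree F"
      using IH(5) dP' by linarith
    ultimately have "degree (B + smult (c ^ N) X) \<le> degree P - degree F"
      by (simp add: degree_add_le)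
    moreover have "coeffs_in A (B + smult (c ^ N) X)"
      using A IH(1) X cA by (intro coeffs_in_add coeffs_in_smult subring_power)
    ultimately show ?thesis
      using eq IH(2,4) unfolding c_def by blast
  qed
qed

text \<open>For a prime \<open>Q\<close> and a subring \<open>A\<close> this is, up to denominators,
  the minimal polynomial of the class of \<open>t\<close> over the fraction field of
  \<open>A\<close> modulo \<open>Q\<close>; the condition on the leading coefficient keeps the
  degree from dropping modulo \<open>Q\<close>.\<close>

definition min_poly_mod :: "'a::comm_ring_1 set \<Rightarrow> 'a set \<Rightarrow> 'a \<Rightarrow> 'a poly \<Rightarrow> bool" where
  "min_poly_mod Q A t F \<longleftrightarrow> is_arg_min degree
     (\<lambda>H. coeffs_in A H \<and> poly H t \<in> Q \<and> lead_coeff H \<notin> Q) F"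

definition algebraic_mod :: "'a::comm_ring_1 set \<Rightarrow> 'a set \<Rightarrow> 'a \<Rightarrow> bool" where
  "algebraic_mod Q A t \<longleftrightarrow> (\<exists>H. coeffs_in A H \<and> poly H t \<in> Q \<and> lead_coeff H \<notin> Q)"

lemma algebraic_mod_mono: "A \<subseteq> B \<Longrightarrow> algebraic_mod Q A t \<Longrightarrow> algebraic_mod Q B t"
  unfolding algebraic_mod_def using coeffs_in_mono by blast

lemma ex_min_poly_mod: "algebraic_mod Q A t \<Longrightarrow> \<exists>F. min_poly_mod Q A t F"
  unfolding algebraic_mod_def min_poly_mod_def is_arg_min_linorder
  by (elim exE, drule ex_has_least_nat[where m = degree]) blast

lemma min_poly_modD:
  assumes "min_poly_mod Q A t F"
  shows "coeffs_in A F" "poly F t \<in> Q" "lead_coeff F \<notin> Q"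
    "\<And>H. coeffs_in A H \<Longrightarrow> poly H t \<in> Q \<Longrightarrow> lead_coeff H \<notin> Q \<Longrightarrow> degree F \<le> degree H"
  using assms by (auto simp: min_poly_mod_def is_arg_min_linorder)

lemma min_poly_mod_degree_pos:
  assumes "min_poly_mod Q A t F"
  shows "degree F > 0"
proof (rule ccontr)
  assume "\<not> degree F > 0"
  then obtain a where "F = [:a:]" by (metis degree_eq_zeroE gr0I)
  then show False using min_poly_modD(2,3)[OF assms] by simp
qed

text \<open>Removing a top term whose coefficient lies in \<open>Q\<close> changes the value at
  \<open>t\<close> only by an element of \<open>Q\<close>. Repeating this replaces the passage to
  the quotient ring.\<close>

lemma poly_strip_lead_in_ideal:
  assumes "is_ideal Q" "subring_set A" "coeffs_in A H"
  shows "(\<forall>i. coeff H i \<in> Q) \<or>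
    (\<exists>H'. coeffs_in A H' \<and> poly H t - poly H' t \<in> Q \<and> lead_coeff H' \<notin> Q \<and> degree H' \<le> degree H)"
  using assms(3)
proof (induction "degree H" arbitrary: H rule: less_induct)
  case less
  show ?case
  proof (cases "lead_coeff H \<in> Q")
    case False
    then show ?thesis
      using less.prems ideal_zero[OF assms(1)] by (intro disjI2 exI[of _ H]) auto
  next
    case True
    show ?thesis
    proof (cases "degree H = 0")
      case deg: True
      then have "coeff H i \<in> Q" for i
        using True ideal_zero[OF assms(1)] by (cases "i = 0") (auto simp: coeff_eq_0)
      then show ?thesis by blast
    next
      case deg: False
      define H1 where "H1 = H - monom (lead_coeff H) (degree H)"
      have H1: "degree H1 < degree H"
        using deg degree_diff_lead_monom by (simp add: H1_def)
      have A1: "coeffs_in A H1"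
        unfolding H1_def using assms(2) less.prems
        by (intro coeffs_in_diff coeffs_in_monom) (auto simp: coeffs_in_def)
      have diff: "poly H t - poly H1 t \<in> Q"
        using True assms(1) by (simp add: H1_def poly_monom ideal_mult_right)
      from less.hyps[OF H1 A1] show ?thesis
      proof
        assume *: "\<forall>i. coeff H1 i \<in> Q"
        have "coeff H i \<in> Q" for i
        proof (cases "i = degree H")
          case False
          then have "coeff H1 i = coeff H i" by (simp add: H1_def)
          then show ?thesis using * by metis
        qed (use True in simp)
        then show ?thesis by blast
      next
        assume "\<exists>H'. coeffs_in A H' \<and> poly H1 t - poly H' t \<in> Q \<and> lead_coeff H' \<notin> Q \<and> degree H' \<le> degree H1"
        then obtain H' where H': "coeffs_in A H'" "poly H1 t - poly H' t \<in> Q" "lead_coeff H' \<notin> Q"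
          "degree H' \<le> degree H1" by blast
        then have "poly H t - poly H' t \<in> Q"
          using ideal_add[OF assms(1) diff H'(2)] by simp
        then show ?thesis using H' H1 by (intro disjI2 exI[of _ H']) auto
      qed
    qed
  qed
qed

lemma min_poly_mod_lower_degree:
  assumes "is_ideal Q" "subring_set A" "min_poly_mod Q A t F"
    and "coeffs_in A H" "poly H t \<in> Q" "degree H < degree F"
  shows "coeff H i \<in> Q"
proof (rule ccontr)
  assume "coeff H i \<notin> Q"
  then obtain H' where H': "coeffs_in A H'" "poly H t - poly H' t \<in> Q" "lead_coeff H' \<notin> Q"
      "degree H' \<le> degree H"
    using poly_strip_lead_in_ideal[OF assms(1,2,4)] by blast
  have "poly H' t \<in> Q"
    using ideal_minus[OF assms(1,5) H'(2)] by simp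
  then show False
    using min_poly_modD(4)[OF assms(3) H'(1)] H' assms(6) by linarith
qed

text \<open>Separability in characteristic zero: the derivative has smaller degree, so if its value
  at \<open>t\<close> lay in \<open>Q\<close>, all its coefficients would, among them
  \<open>degree F\<close> times the leading coefficient of \<open>F\<close>. The assumption
  \<open>unit\<close> excludes that.\<close>

lemma min_poly_mod_formal_deriv:
  assumes "is_prime_ideal Q" "subring_set A" "min_poly_mod Q A t F"
    and unit: "\<And>n. n > 0 \<Longrightarrow> of_nat n \<notin> Q"
  shows "poly (formal_deriv F) t \<notin> Q"
proof
  assume *: "poly (formal_deriv F) t \<in> Q"
  note F = min_poly_modD[OF assms(3)] min_poly_mod_degree_pos[OF assms(3)]
  have "degree (formal_deriv F) \<le> degree F - 1"
    by (intro degree_le) (auto simp: coeff_formal_deriv coeff_eq_0)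
  then have "degree (formal_deriv F) < degree F" using F(5) by linarith
  then have "coeff (formal_deriv F) (degree F - 1) \<in> Q"
    using min_poly_mod_lower_degree[OF prime_idealD(1)[OF assms(1)] assms(2,3)]
      coeffs_in_formal_deriv[OF assms(2) F(1)] * by blast
  then have "of_nat (degree F) * lead_coeff F \<in> Q"
    using F(5) by (simp add: coeff_formal_deriv)
  then show False
    using prime_idealD(2)[OF assms(1)] unit F by blast
qed

text \<open>Otherwise a witness \<open>P\<close> of smallest degree would, by pseudo-division, be a proper factor of
  the minimal polynomial of \<open>t\<close> modulo \<open>Q\<close>.\<close>

lemma descend_algebraic:
  assumes Q: "is_prime_ideal Q" and Q': "is_ideal Q'" "Q \<subseteq> Q'" and A: "subring_set A"
    and alg: "algebraic_mod Q A t"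
    and P: "coeffs_in A P" "poly P t \<in> Q'" "poly P t \<notin> Q"
  shows "\<exists>a\<in>A. a \<in> Q' \<and> a \<notin> Q"
proof -
  note Qi = prime_idealD(1)[OF Q] and Qp = prime_idealD(2)[OF Q]
  define good where "good = (\<lambda>H. coeffs_in A H \<and> poly H t \<in> Q' \<and> poly H t \<notin> Q)"
  obtain P0 where P0: "good P0" and min: "\<And>H. good H \<Longrightarrow> degree P0 \<le> degree H"
    using ex_has_least_nat[of good P degree] P by (auto simp: good_def)
  obtain P1 where P1: "coeffs_in A P1" "poly P0 t - poly P1 t \<in> Q" "lead_coeff P1 \<notin> Q"
      "degree P1 \<le> degree P0"
  proof -
    have "poly P0 t \<in> Q" if "\<forall>i. coeff P0 i \<in> Q"
      unfolding poly_altdef using that Qi by (auto intro!: ideal_sum ideal_mult_right)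
    then show ?thesis
      using that poly_strip_lead_in_ideal[OF Qi A, of P0] P0 by (auto simp: good_def)
  qed
  have g1: "good P1"
    unfolding good_def
  proof (intro conjI P1(1))
    show "poly P1 t \<in> Q'"
      using ideal_minus[OF Q'(1), of "poly P0 t" "poly P0 t - poly P1 t"] P0 P1(2) Q'(2)
      by (auto simp: good_def)
    show "poly P1 t \<notin> Q"
      using ideal_add[OF Qi P1(2), of "poly P1 t"] P0 by (auto simp: good_def)
  qed
  have min1: "degree P1 \<le> degree H" if "good H" for H
    using min[OF that] P1(4) by linarith
  show ?thesis
  proof (cases "degree P1 = 0")
    case True
    then obtain a where "P1 = [:a:]" by (metis degree_eq_zeroE)
    moreover from this have "a \<in> A" using P1(1) by (auto simp: coeffs_in_def dest: spec[of _ 0])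
    ultimately show ?thesis using g1 by (auto simp: good_def)
  next
    case False
    obtain F where F: "min_poly_mod Q A t F"
      using ex_min_poly_mod[OF alg] by blast
    note FD = min_poly_modD[OF F] min_poly_mod_degree_pos[OF F]
    \<comment> \<open>The remainder of \<open>P1\<close> on division by \<open>F\<close> is again
      \<open>good\<close>, so the minimality of \<open>P1\<close> bounds its degree from
      below.\<close>
    have "degree P1 < degree F"
    proof -
      obtain N B R where d: "coeffs_in A B" "coeffs_in A R"
        "smult (lead_coeff F ^ N) P1 = F * B + R" "degree R < degree F"
        using pseudo_division_over[OF A FD(1,5) P1(1)] by blast
      have eq: "lead_coeff F ^ N * poly P1 t = poly F t * poly B t + poly R t"
        using arg_cong[OF d(3), of "\<lambda>H. poly H t"] by simp
      have FB: "poly F t * poly B t \<in> Q"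
        using FD(2) Qi by (simp add: ideal_mult_right)
      have "good R"
        unfolding good_def
      proof (intro conjI d(2))
        have "lead_coeff F ^ N * poly P1 t \<in> Q'"
          using g1 Q'(1) by (simp add: good_def ideal_mult_left)
        moreover have "poly R t = lead_coeff F ^ N * poly P1 t - poly F t * poly B t"
          using eq by simp
        ultimately show "poly R t \<in> Q'"
          using FB Q' ideal_minus[OF Q'(1)] by (metis subsetD)
        show "poly R t \<notin> Q"
        proof
          assume "poly R t \<in> Q"
          then have "lead_coeff F ^ N * poly P1 t \<in> Q"
            using ideal_add[OF Qi FB] eq by simp
          then show False
            using Qp prime_ideal_power[OF Q] FD(3) g1 by (auto simp: good_def)
        qed
      qed
      from min1[OF this] d(4) show ?thesis by linarith
    qed
    \<comment> \<open>Now divide the other way. The remainder has too small a degree to be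
      \<open>good\<close>, so its value lies in \<open>Q\<close>, and primality puts the value of
      \<open>B\<close> in \<open>Q\<close> too. Since \<open>degree P1 > 0\<close>, \<open>B\<close>
      has smaller degree than \<open>F\<close>.\<close>
    obtain N B R where d: "coeffs_in A B" "coeffs_in A R"
      "smult (lead_coeff P1 ^ N) F = P1 * B + R" "degree R < degree P1"
      "degree B \<le> degree F - degree P1"
      using pseudo_division_over[OF A P1(1) _ FD(1)] False by blast
    have eq: "lead_coeff P1 ^ N * poly F t = poly P1 t * poly B t + poly R t"
      using arg_cong[OF d(3), of "\<lambda>H. poly H t"] by simp
    have lF: "lead_coeff P1 ^ N * poly F t \<in> Q"
      using FD(2) Qi by (simp add: ideal_mult_left)
    have R: "poly R t = lead_coeff P1 ^ N * poly F t - poly P1 t * poly B t"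
      using eq by simp
    have "poly R t \<in> Q'"
      unfolding R using lF Q' g1 by (intro ideal_minus) (auto simp: good_def ideal_mult_right)
    then have "poly R t \<in> Q"
      using min1[of R] d(2,4) by (force simp: good_def)
    then have "poly P1 t * poly B t \<in> Q"
      using ideal_minus[OF Qi lF \<open>poly R t \<in> Q\<close>] eq by simp
    then have "poly B t \<in> Q"
      using Qp g1 by (auto simp: good_def)
    moreover have "degree B < degree F"
      using d(5) False \<open>degree P1 < degree F\<close> by linarith
    ultimately have BQ: "coeff B i \<in> Q" for i
      using min_poly_mod_lower_degree[OF Qi A F d(1)] by blast
    \<comment> \<open>In degree \<open>degree F\<close> the remainder contributes nothing and
      \<open>P1 * B\<close> only elements of \<open>Q\<close>, although both leading coefficients
      lie outside \<open>Q\<close>.\<close>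
    have coeff_eq: "lead_coeff P1 ^ N * lead_coeff F = coeff (P1 * B) (degree F) + coeff R (degree F)"
      using arg_cong[OF d(3), of "\<lambda>H. coeff H (degree F)"] by simp
    have "coeff R (degree F) = 0"
      using d(4) \<open>degree P1 < degree F\<close> by (simp add: coeff_eq_0)
    moreover have "coeff (P1 * B) (degree F) \<in> Q"
      unfolding coeff_mult using BQ Qi by (auto intro!: ideal_sum ideal_mult_left)
    ultimately have "lead_coeff P1 ^ N * lead_coeff F \<in> Q"
      using coeff_eq by simp
    then show ?thesis
      using Qp prime_ideal_power[OF Q] FD(3) P1(3) by blast
  qed
qed

section \<open>Multivariate polynomials and their subrings\<close>

lemma peval_superset:
  assumes "finite A" "Poly_Mapping.keys p \<subseteq> A"
  shows "peval p x = (\<Sum>\<mu>\<in>A. Poly_Mapping.lookup p \<mu> * (\<Prod>i\<in>UNIV. (x $ i) ^ Poly_Mapping.lookup \<mu> i))"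
  unfolding peval_def using assms
  by (intro sum.mono_neutral_left) (auto simp: in_keys_iff)

lemma peval_0 [simp]: "peval 0 x = 0"
  by (simp add: peval_def)

lemma peval_add [simp]: "peval (p + q) x = peval p x + peval q x"
proof -
  let ?A = "Poly_Mapping.keys p \<union> Poly_Mapping.keys q"
  have "Poly_Mapping.keys (p + q) \<subseteq> ?A"
    by (rule Poly_Mapping.keys_add)
  then show ?thesis
    by (simp add: peval_superset[of ?A] lookup_add distrib_right sum.distrib)
qed

lemma peval_single:
  "peval (Poly_Mapping.single \<mu> c) x = c * (\<Prod>i\<in>UNIV. (x $ i) ^ Poly_Mapping.lookup \<mu> i)"
  by (simp add: peval_def)

lemma peval_sum [simp]: "peval (sum f A) x = (\<Sum>a\<in>A. peval (f a) x)"
  by (induction A rule: infinite_finite_induct) auto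

lemma poly_mapping_sum_single:
  "p = (\<Sum>\<mu>\<in>Poly_Mapping.keys p. Poly_Mapping.single \<mu> (Poly_Mapping.lookup p \<mu>))"
proof (rule poly_mapping_eqI)
  fix k
  have "Poly_Mapping.lookup (\<Sum>\<mu>\<in>Poly_Mapping.keys p. Poly_Mapping.single \<mu> (Poly_Mapping.lookup p \<mu>)) k
    = (\<Sum>\<mu>\<in>Poly_Mapping.keys p. if \<mu> = k then Poly_Mapping.lookup p \<mu> else 0)"
    by (simp add: lookup_sum lookup_single when_def)
  also have "\<dots> = Poly_Mapping.lookup p k"
    by (simp add: sum.delta in_keys_iff)
  finally show "Poly_Mapping.lookup p k = Poly_Mapping.lookup (\<Sum>\<mu>\<in>Poly_Mapping.keys p.
      Poly_Mapping.single \<mu> (Poly_Mapping.lookup p \<mu>)) k" by simp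
qed

lemma peval_mult [simp]: "peval (p * q) x = peval p x * peval q x"
proof -
  have *: "peval (Poly_Mapping.single \<mu> c * Poly_Mapping.single \<nu> d) x
    = peval (Poly_Mapping.single \<mu> c) x * peval (Poly_Mapping.single \<nu> d) x" for \<mu> \<nu> c d
    by (simp add: mult_single peval_single lookup_add power_add prod.distrib)
  show ?thesis
    by (subst (1 2) poly_mapping_sum_single[of p], subst (1 2) poly_mapping_sum_single[of q])
      (simp only: sum_product peval_sum *)
qed

abbreviation pconst :: "real \<Rightarrow> 'n rpoly" where
  "pconst c \<equiv> Poly_Mapping.single 0 c"

definition pvar :: "'n \<Rightarrow> 'n rpoly" where
  "pvar i = Poly_Mapping.single (Poly_Mapping.single i 1) 1"

lemma peval_pconst [simp]: "peval (pconst c) x = c"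
  by (simp add: peval_single)

lemma peval_pvar [simp]: "peval (pvar i) x = x $ i"
proof -
  have "(\<Prod>k\<in>UNIV. (x $ k) ^ Poly_Mapping.lookup (Poly_Mapping.single i 1) k)
    = (\<Prod>k\<in>UNIV. if k = i then x $ k else 1)"
    by (intro prod.cong) (auto simp: lookup_single when_def)
  then show ?thesis
    by (simp add: pvar_def peval_single prod.delta)
qed

lemma peval_1 [simp]: "peval 1 x = 1"
  using peval_pconst[of 1 x] by (simp only: single_one)

lemma peval_uminus [simp]: "peval (- p) x = - peval p x"
  using peval_add[of p "- p" x] by simp

lemma peval_diff [simp]: "peval (p - q) x = peval p x - peval q x"
  using peval_add[of p "- q" x] by simp

lemma peval_of_nat [simp]: "peval (of_nat k) x = of_nat k"
  by (induction k) auto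

lemma peval_power [simp]: "peval (p ^ k) x = peval p x ^ k"
  by (induction k) auto

lemma continuous_on_peval [continuous_intros]:
  "continuous_on S f \<Longrightarrow> continuous_on S (\<lambda>x. peval p (f x))"
  unfolding peval_def by (intro continuous_intros)

lemma open_peval_neq: "open {x. peval p x \<noteq> 0}"
  by (intro open_Collect_neq continuous_intros)

abbreviation eval_coeffs :: "real^'n \<Rightarrow> 'n::finite rpoly poly \<Rightarrow> real poly" where
  "eval_coeffs x \<equiv> map_poly (\<lambda>c. peval c x)"

lemma peval_poly: "peval (poly F t) x = poly (eval_coeffs x F) (peval t x)"
  by (induction F) (auto simp: map_poly_pCons)

lemma eval_coeffs_formal_deriv: "eval_coeffs x (formal_deriv F) = pderiv (eval_coeffs x F)"
  by (rule poly_eqI) (simp add: coeff_pderiv coeff_formal_deriv coeff_map_poly del: of_nat_Suc)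

section \<open>Subrings generated by a set of variables\<close>

inductive_set polys_in :: "'n set \<Rightarrow> 'n rpoly set" for G where
  const: "pconst c \<in> polys_in G"
| var: "i \<in> G \<Longrightarrow> pvar i \<in> polys_in G"
| add: "p \<in> polys_in G \<Longrightarrow> q \<in> polys_in G \<Longrightarrow> p + q \<in> polys_in G"
| mult: "p \<in> polys_in G \<Longrightarrow> q \<in> polys_in G \<Longrightarrow> p * q \<in> polys_in G"

lemma subring_polys_in [simp]: "subring_set (polys_in G)"
proof -
  have "p - q \<in> polys_in G" if "p \<in> polys_in G" "q \<in> polys_in G" for p q
  proof -
    have "pconst (-1) * q = - q"
      by (simp add: single_uminus)
    then show ?thesis
      using polys_in.add[OF that(1) polys_in.mult[OF polys_in.const[of "-1"] that(2)]] by simp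
  qed
  then show ?thesis
    using polys_in.const[of 0 G] polys_in.const[of 1 G]
    by (auto simp: subring_set_def intro: polys_in.intros)
qed

lemma polys_in_mono: "G \<subseteq> H \<Longrightarrow> polys_in G \<subseteq> polys_in H"
proof
  fix p assume "p \<in> polys_in G" "G \<subseteq> H"
  then show "p \<in> polys_in H"
    by induction (auto intro: polys_in.intros)
qed

lemma polys_in_UNIV [simp]: "polys_in (UNIV :: 'n::finite set) = UNIV"
proof -
  have var_power: "pvar i ^ k = Poly_Mapping.single (Poly_Mapping.single i k) 1" for i :: 'n and k
  proof (induction k)
    case (Suc k)
    have "pvar i ^ Suc k = Poly_Mapping.single (Poly_Mapping.single i 1 + Poly_Mapping.single i k) 1"
      by (simp only: power_Suc Suc) (simp add: pvar_def mult_single)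
    also have "Poly_Mapping.single i 1 + Poly_Mapping.single i k = Poly_Mapping.single i (Suc k)"
      by (simp flip: single_add)
    finally show ?case .
  qed simp
  have monomial: "Poly_Mapping.single (\<Sum>i\<in>A. Poly_Mapping.single i (m i)) 1 = (\<Prod>i\<in>A. pvar i ^ m i)"
    for A :: "'n set" and m
  proof (induction A rule: infinite_finite_induct)
    case (insert x A)
    then have "(\<Prod>i\<in>insert x A. pvar i ^ m i) = Poly_Mapping.single (Poly_Mapping.single x (m x)) 1
        * Poly_Mapping.single (\<Sum>i\<in>A. Poly_Mapping.single i (m i)) 1"
      by (simp add: var_power)
    then show ?case using insert.hyps by (simp add: mult_single)
  qed simp_all
  have in_sub: "(\<Prod>i\<in>A. pvar i ^ m i) \<in> polys_in UNIV" for A :: "'n set" and m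
    by (induction A rule: infinite_finite_induct)
      (auto intro!: polys_in.mult subring_power polys_in.var simp: subring_polys_in[unfolded subring_set_def])
  have "Poly_Mapping.single \<mu> c \<in> polys_in UNIV" for \<mu> :: "'n \<Rightarrow>\<^sub>0 nat" and c :: real
  proof -
    have "\<mu> = (\<Sum>i\<in>UNIV. Poly_Mapping.single i (Poly_Mapping.lookup \<mu> i))"
      by (rule poly_mapping_eqI) (simp add: lookup_sum lookup_single when_def)
    then have "Poly_Mapping.single \<mu> 1 = (\<Prod>i\<in>UNIV. pvar i ^ Poly_Mapping.lookup \<mu> i)"
      using monomial[where A = UNIV and m = "Poly_Mapping.lookup \<mu>"] by simp
    moreover have "Poly_Mapping.single \<mu> c = pconst c * Poly_Mapping.single \<mu> 1"
      by (simp add: mult_single)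
    ultimately show ?thesis
      using in_sub polys_in.const polys_in.mult by metis
  qed
  then have "p \<in> polys_in UNIV" for p :: "'n rpoly"
    by (subst poly_mapping_sum_single) (intro subring_sum subring_polys_in)
  then show ?thesis by blast
qed

lemma polys_in_empty: "p \<in> polys_in {} \<Longrightarrow> \<exists>c. p = pconst c"
  by (induction rule: polys_in.induct) (auto simp flip: single_add simp: mult_single)

text \<open>This feeds the univariate arguments into inductions on the set of variables.\<close>

lemma polys_in_insert:
  assumes "p \<in> polys_in (insert j G)"
  shows "\<exists>F. coeffs_in (polys_in G) F \<and> p = poly F (pvar j)"
  using assms
proof induction
  case (const c)
  show ?case
    by (intro exI[of _ "[:pconst c:]"])
      (auto simp: coeffs_in_def coeff_pCons polys_in.const subring_polys_in[unfolded subring_set_def] split: nat.splits)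
next
  case (var i)
  show ?case
  proof (cases "i = j")
    case True
    then show ?thesis
      by (intro exI[of _ "[:0, 1:]"])
        (auto simp: coeffs_in_def coeff_pCons subring_polys_in[unfolded subring_set_def] split: nat.splits)
  next
    case False
    then show ?thesis using var
      by (intro exI[of _ "[:pvar i:]"])
        (auto simp: coeffs_in_def coeff_pCons polys_in.var subring_polys_in[unfolded subring_set_def] split: nat.splits)
  qed
next
  case (add p q)
  then show ?case by (metis coeffs_in_add poly_add subring_polys_in)
next
  case (mult p q)
  then show ?case by (metis coeffs_in_mult poly_mult subring_polys_in)
qed

lemma peval_cong_on:
  "p \<in> polys_in G \<Longrightarrow> (\<And>i. i \<in> G \<Longrightarrow> x $ i = y $ i) \<Longrightarrow> peval p x = peval p y"
  by (induction rule: polys_in.induct) auto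

lemma eval_coeffs_cong:
  "coeffs_in (polys_in G) F \<Longrightarrow> (\<And>i. i \<in> G \<Longrightarrow> x $ i = y $ i) \<Longrightarrow> eval_coeffs x F = eval_coeffs y F"
  by (rule poly_eqI) (auto simp: coeff_map_poly coeffs_in_def intro: peval_cong_on)

definition vupd :: "real^'n \<Rightarrow> 'n::finite \<Rightarrow> real \<Rightarrow> real^'n" where
  "vupd x j t = (\<chi> i. if i = j then t else x $ i)"

lemma vupd_nth [simp]: "vupd x j t $ i = (if i = j then t else x $ i)"
  by (simp add: vupd_def)

lemma vupd_self [simp]: "vupd x j (x $ j) = x"
  by (simp add: vec_eq_iff)

lemma continuous_on_vupd [continuous_intros]:
  assumes "continuous_on S f" "continuous_on S g"
  shows "continuous_on S (\<lambda>x. vupd (f x) j (g x))"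
proof -
  have "continuous_on S (\<lambda>x. if i = j then g x else f x $ i)" for i
    using assms by (cases "i = j") (auto intro: continuous_intros)
  then show ?thesis
    unfolding vupd_def by (intro continuous_on_vec_lambda) auto
qed

text \<open>An open set meets the line through each of its points in direction \<open>j\<close> in
  infinitely many points, so the univariate polynomial in that variable is zero there. Its
  coefficients then vanish on the open set, and the induction applies.\<close>

lemma polys_in_vanish_open:
  assumes "p \<in> polys_in G" "open O'" "O' \<noteq> {}" "\<And>x. x \<in> O' \<Longrightarrow> peval p x = 0"
  shows "p = 0"
proof -
  have "finite G" by simp
  then show ?thesis using assms(1,4)
  proof (induction G arbitrary: p)
    case empty
    then obtain c where "p = pconst c" using polys_in_empty by blast
    then show ?case using empty(2) assms(3) by fastforce
  next
    case (insert j G)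
    obtain F where F: "coeffs_in (polys_in G) F" "p = poly F (pvar j)"
      using polys_in_insert[OF insert.prems(1)] by blast
    have "eval_coeffs x F = 0" if x: "x \<in> O'" for x
    proof (rule ccontr)
      assume nz: "eval_coeffs x F \<noteq> 0"
      let ?T = "{t. vupd x j t \<in> O'}"
      have "open ?T"
        using open_vimage[OF \<open>open O'\<close>, of "vupd x j"] by (simp add: vimage_def continuous_intros)
      moreover have "x $ j \<in> ?T" using x by simp
      ultimately have "infinite ?T"
        using finite_imp_not_open by blast
      moreover have "poly (eval_coeffs x F) t = 0" if "t \<in> ?T" for t
      proof -
        have "eval_coeffs (vupd x j t) F = eval_coeffs x F"
          using F(1) insert.hyps by (intro eval_coeffs_cong) auto
        then show ?thesis
          using insert.prems(2)[of "vupd x j t"] that F(2) by (simp add: peval_poly)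
      qed
      ultimately have "infinite {t. poly (eval_coeffs x F) t = 0}"
        by (metis (mono_tags, lifting) infinite_super mem_Collect_eq subsetI)
      then show False
        using poly_roots_finite[OF nz] by blast
    qed
    then have "peval (coeff F i) x = 0" if "x \<in> O'" for i x
      using that by (metis coeff_0 coeff_map_poly peval_0)
    then have "coeff F i = 0" for i
      using insert.IH F(1) by (auto simp: coeffs_in_def)
    then show ?case
      by (simp add: F(2) poly_eqI[of F 0])
  qed
qed

lemma of_nat_notin_prime:
  fixes Q :: "'n rpoly set"
  assumes "is_prime_ideal Q" "k > 0"
  shows "of_nat k \<notin> Q"
proof
  assume *: "of_nat k \<in> Q"
  have "pconst (1 / real k) * of_nat k = 1"
    using assms(2) by (simp add: mult_single flip: single_of_nat)
  then show False
    using prime_idealD(1,3)[OF assms(1)] ideal_mult_left[OF _ *] by metis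
qed

section \<open>Algebraic independence modulo a prime ideal\<close>

definition indep_mod :: "'n rpoly set \<Rightarrow> 'n set \<Rightarrow> bool" where
  "indep_mod Q G \<longleftrightarrow> polys_in G \<inter> Q \<subseteq> {0}"

definition algebraic_over :: "'n rpoly set \<Rightarrow> 'n set \<Rightarrow> bool" where
  "algebraic_over Q F \<longleftrightarrow> (\<forall>j. algebraic_mod Q (polys_in F) (pvar j))"

lemma indep_mod_antimono: "Q \<subseteq> Q' \<Longrightarrow> H \<subseteq> G \<Longrightarrow> indep_mod Q' G \<Longrightarrow> indep_mod Q H"
  using polys_in_mono[of H G] by (auto simp: indep_mod_def)

lemma indep_mod_empty:
  assumes "is_prime_ideal Q"
  shows "indep_mod Q {}"
  unfolding indep_mod_def
proof
  fix p assume p: "p \<in> polys_in {} \<inter> Q"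
  then obtain c where c: "p = pconst c" using polys_in_empty by blast
  have "pconst (1 / c) * p = 1" if "c \<noteq> 0"
    using that by (simp add: c mult_single)
  moreover have "pconst (1 / c) * p \<in> Q"
    using p prime_idealD(1)[OF assms] by (intro ideal_mult_left) auto
  ultimately have "c = 0"
    using prime_idealD(3)[OF assms] by metis
  then show "p \<in> {0}" by (simp add: c)
qed

text \<open>Take \<open>F\<close> maximal. For \<open>j\<close> outside \<open>F\<close>, a relation
  between \<open>pvar j\<close> and the variables of \<open>F\<close> is a univariate polynomial
  whose coefficients, by independence, do not all lie in \<open>Q\<close>; stripping it leaves one
  with leading coefficient outside \<open>Q\<close>.\<close>

lemma extend_indep_mod:
  fixes G :: "'n::finite set"
  assumes "is_prime_ideal Q" "indep_mod Q G"
  shows "\<exists>F. G \<subseteq> F \<and> indep_mod Q F \<and> algebraic_over Q F"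
proof -
  let ?S = "{F. G \<subseteq> F \<and> indep_mod Q F}"
  have "\<exists>F\<in>?S. G \<subseteq> F \<and> (\<forall>H\<in>?S. F \<subseteq> H \<longrightarrow> F = H)"
    using assms(2) by (intro finite_has_maximal2) auto
  then obtain F where F: "G \<subseteq> F" "indep_mod Q F"
    and max: "\<And>H. G \<subseteq> H \<Longrightarrow> indep_mod Q H \<Longrightarrow> F \<subseteq> H \<Longrightarrow> F = H"
    by auto
  note Qi = prime_idealD(1)[OF assms(1)]
  have "algebraic_mod Q (polys_in F) (pvar j)" for j
  proof (cases "j \<in> F")
    case True
    have "pvar j \<in> polys_in F" using True by (rule polys_in.var)
    moreover have "- a = 0 - a" for a :: "'n rpoly" by simp
    ultimately have "coeffs_in (polys_in F) [:- pvar j, 1:]"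
      using subring_polys_in[of F, unfolded subring_set_def]
      by (auto simp: coeffs_in_def coeff_pCons split: nat.splits)
    moreover have "poly [:- pvar j, 1:] (pvar j) \<in> Q"
      using ideal_zero[OF Qi] by simp
    moreover have "lead_coeff [:- pvar j, 1:] \<notin> Q"
      using prime_idealD(3)[OF assms(1)] by simp
    ultimately show ?thesis
      unfolding algebraic_mod_def by blast
  next
    case False
    then have "\<not> indep_mod Q (insert j F)"
      using max[of "insert j F"] F by blast
    then obtain p where p: "p \<in> polys_in (insert j F)" "p \<in> Q" "p \<noteq> 0"
      by (auto simp: indep_mod_def)
    obtain H where H: "coeffs_in (polys_in F) H" "p = poly H (pvar j)"
      using polys_in_insert[OF p(1)] by blast
    have "\<not> (\<forall>i. coeff H i \<in> Q)"
    proof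
      assume "\<forall>i. coeff H i \<in> Q"
      then have "coeff H i = 0" for i
        using H(1) F(2) by (auto simp: coeffs_in_def indep_mod_def)
      then show False using H(2) p(3) by (simp add: poly_eqI[of H 0])
    qed
    then obtain H' where H': "coeffs_in (polys_in F) H'" "poly H (pvar j) - poly H' (pvar j) \<in> Q"
        "lead_coeff H' \<notin> Q"
      using poly_strip_lead_in_ideal[OF Qi subring_polys_in H(1)] by blast
    have "poly H' (pvar j) \<in> Q"
      using ideal_minus[OF Qi _ H'(2), of p] p(2) H(2) by simp
    then show ?thesis
      unfolding algebraic_mod_def using H' by blast
  qed
  then show ?thesis
    using F unfolding algebraic_over_def by blast
qed

lemma descend_to_base:
  fixes F :: "'n::finite set"
  assumes Q: "is_prime_ideal Q" and Q': "is_ideal Q'" "Q \<subset> Q'" and alg: "algebraic_over Q F"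
  shows "\<exists>a\<in>polys_in F. a \<in> Q' \<and> a \<notin> Q"
proof -
  have "\<exists>a\<in>polys_in F. a \<in> Q' \<and> a \<notin> Q"
    if "finite J" "p \<in> polys_in (F \<union> J)" "p \<in> Q'" "p \<notin> Q" for J p
    using that
  proof (induction J arbitrary: p)
    case empty
    then show ?case by auto
  next
    case (insert j J)
    obtain P where P: "coeffs_in (polys_in (F \<union> J)) P" "p = poly P (pvar j)"
      using polys_in_insert[of p j "F \<union> J"] insert.prems(1) by auto
    have "algebraic_mod Q (polys_in (F \<union> J)) (pvar j)"
      using alg algebraic_mod_mono[OF polys_in_mono[of F "F \<union> J"]] by (auto simp: algebraic_over_def)
    then obtain a where "a \<in> polys_in (F \<union> J)" "a \<in> Q'" "a \<notin> Q"
      using descend_algebraic[OF Q Q'(1) _ subring_polys_in _ P(1)] Q'(2) insert.prems P(2) by blast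
    then show ?case using insert.IH by blast
  qed
  from this[of UNIV] Q'(2) show ?thesis by auto
qed

text \<open>Enlarge \<open>G\<close> to an independent set \<open>F\<close> modulo \<open>Q\<close>
  over which all variables are algebraic. The larger prime contains a nonzero element of
  \<open>polys_in F\<close>, so \<open>F\<close> is dependent modulo \<open>Q'\<close> and must
  exceed \<open>G\<close>.\<close>

lemma strict_prime_indep_mod:
  fixes G :: "'n::finite set"
  assumes "is_prime_ideal Q" "is_prime_ideal Q'" "Q \<subset> Q'" "indep_mod Q' G"
  shows "\<exists>F. indep_mod Q F \<and> card F > card G"
proof -
  have "indep_mod Q G"
    using assms(3,4) indep_mod_antimono[of Q Q' G G] by blast
  then obtain F where F: "G \<subseteq> F" "indep_mod Q F" "algebraic_over Q F"
    using extend_indep_mod[OF assms(1)] by blast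
  obtain a where a: "a \<in> polys_in F" "a \<in> Q'" "a \<notin> Q"
    using descend_to_base[OF assms(1) prime_idealD(1)[OF assms(2)] assms(3) F(3)] by blast
  have "a \<noteq> 0"
    using a(3) ideal_zero[OF prime_idealD(1)[OF assms(1)]] by blast
  then have "F \<noteq> G"
    using a assms(4) by (auto simp: indep_mod_def)
  then have "card G < card F"
    using F(1) by (intro psubset_card_mono) auto
  then show ?thesis
    using F(2) by blast
qed

section \<open>Prime chains and Krull dimension\<close>

definition prime_chain :: "'a::comm_ring_1 set list \<Rightarrow> bool" where
  "prime_chain Qs \<longleftrightarrow> (\<forall>Q\<in>set Qs. is_prime_ideal Q) \<and> sorted_wrt (\<subset>) Qs"

text \<open>Induction from the top of the chain: the last prime starts with the empty set and each
  strict inclusion gains a variable, so \<open>d + 1\<close> primes yield \<open>d\<close>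
  variables.\<close>

lemma prime_chain_indep_mod:
  fixes Qs :: "'n::finite rpoly set list"
  assumes "prime_chain Qs" "length Qs = Suc d"
  shows "\<exists>G. indep_mod (hd Qs) G \<and> d \<le> card G"
  using assms
proof (induction d arbitrary: Qs)
  case 0
  then obtain Q where "Qs = [Q]" by (auto simp: length_Suc_conv)
  then show ?case
    using 0 indep_mod_empty by (auto simp: prime_chain_def)
next
  case (Suc d)
  then obtain Q Qs' where Qs: "Qs = Q # Qs'" "length Qs' = Suc d"
    by (auto simp: length_Suc_conv)
  have "prime_chain Qs'"
    using Suc.prems(1) by (auto simp: prime_chain_def Qs)
  then obtain G where G: "indep_mod (hd Qs') G" "d \<le> card G"
    using Suc.IH Qs(2) by blast
  have "hd Qs' \<in> set Qs'"
    using Qs(2) by (intro hd_in_set) auto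
  then have "is_prime_ideal Q" "is_prime_ideal (hd Qs')" "Q \<subset> hd Qs'"
    using Suc.prems(1) by (auto simp: prime_chain_def Qs(1))
  then show ?case
    using strict_prime_indep_mod[OF _ _ _ G(1)] G(2) Qs(1) by force
qed

lemma krull_dim_eq_Greatest:
  assumes "is_prime_ideal P"
  shows "krull_dim P = int (GREATEST d. \<exists>Qs. length Qs = Suc d \<and> prime_chain Qs \<and> P \<subseteq> hd Qs)"
proof -
  have "P \<noteq> UNIV" using assms by (auto simp: is_prime_ideal_def)
  moreover have "(\<lambda>d. \<exists>Qs. length Qs = Suc d \<and> (\<forall>Q\<in>set Qs. is_prime_ideal Q) \<and> P \<subseteq> hd Qs \<and> sorted_wrt (\<subset>) Qs)
    = (\<lambda>d. \<exists>Qs. length Qs = Suc d \<and> prime_chain Qs \<and> P \<subseteq> hd Qs)"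
    by (auto simp: prime_chain_def fun_eq_iff)
  ultimately show ?thesis
    by (simp add: krull_dim_def)
qed

text \<open>\<open>GREATEST\<close> is a true maximum only for a bounded, satisfiable predicate:
  independent sets bound the chain lengths by the number of variables, and \<open>[P]\<close> is a
  chain.\<close>

lemma krull_dim_obtains:
  fixes P :: "'n::finite rpoly set"
  assumes "is_prime_ideal P"
  obtains k G where "krull_dim P = int k" "indep_mod P G" "k \<le> card G"
    "\<And>Qs d. prime_chain Qs \<Longrightarrow> length Qs = Suc d \<Longrightarrow> P \<subseteq> hd Qs \<Longrightarrow> d \<le> k"
proof -
  define C where "C = (\<lambda>d. \<exists>Qs. length Qs = Suc d \<and> prime_chain Qs \<and> P \<subseteq> hd Qs)"
  have C: "\<exists>G. indep_mod P G \<and> d \<le> card G" if "C d" for d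
    using that prime_chain_indep_mod indep_mod_antimono unfolding C_def by blast
  have bound: "d \<le> CARD('n)" if "C d" for d
    using C[OF that] by (meson card_mono finite order_trans subset_UNIV)
  have "C 0"
    unfolding C_def using assms by (intro exI[of _ "[P]"]) (auto simp: prime_chain_def)
  then have "C (GREATEST d. C d)"
    using bound by (rule GreatestI_nat)
  moreover have "d \<le> (GREATEST d. C d)" if "C d" for d
    using that bound by (rule Greatest_le_nat)
  moreover have "krull_dim P = int (GREATEST d. C d)"
    using krull_dim_eq_Greatest[OF assms] by (simp add: C_def)
  ultimately show ?thesis
    using C that by (metis C_def)
qed

section \<open>Local structure of real zero sets\<close>

text \<open>A simple root moves continuously: near \<open>t0\<close> the function is strictly
  monotone in \<open>t\<close>, so the intermediate value theorem gives a root, and the sign at a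
  point tells on which side of it the root lies. In the parameter only continuity is asked for,
  since it will enter through a section that is merely continuous.\<close>

lemma implicit_root:
  fixes u u' :: "'a::topological_space \<Rightarrow> real \<Rightarrow> real"
  assumes W: "open W" "x0 \<in> W"
    and cu: "continuous_on (W \<times> UNIV) (\<lambda>z. u (fst z) (snd z))"
    and cu': "continuous_on (W \<times> UNIV) (\<lambda>z. u' (fst z) (snd z))"
    and deriv: "\<And>x t. x \<in> W \<Longrightarrow> (u x has_real_derivative u' x t) (at t)"
    and root: "u x0 t0 = 0" "u' x0 t0 \<noteq> 0"
  obtains W' \<psi> where "open W'" "x0 \<in> W'" "W' \<subseteq> W" "continuous_on W' \<psi>" "\<psi> x0 = t0"
    "\<And>x. x \<in> W' \<Longrightarrow> u x (\<psi> x) = 0"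
proof -
  define s where "s = sgn (u' x0 t0)"
  define v where "v = (\<lambda>x t. s * u x t)"
  have s: "s \<noteq> 0" "s * u' x0 t0 > 0"
    using root(2) by (auto simp: s_def sgn_if)
  have cv: "continuous_on W (\<lambda>x. v x a)" for a
  proof -
    have "continuous_on W ((\<lambda>z. u (fst z) (snd z)) \<circ> (\<lambda>x. (x, a)))"
      by (intro continuous_on_compose continuous_intros continuous_on_subset[OF cu]) auto
    then show ?thesis
      unfolding v_def by (intro continuous_intros) (simp add: o_def)
  qed
  have opn: "open ((W \<times> UNIV) \<inter> (\<lambda>z. s * u' (fst z) (snd z)) -` {0<..})"
    using W(1) cu' by (intro continuous_open_preimage continuous_intros open_Times) auto
  have mem: "(x0, t0) \<in> (W \<times> UNIV) \<inter> (\<lambda>z. s * u' (fst z) (snd z)) -` {0<..}"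
    using W(2) s(2) by auto
  obtain A B where AB': "open A" "open B" "(x0, t0) \<in> A \<times> B"
    "A \<times> B \<subseteq> (W \<times> UNIV) \<inter> (\<lambda>z. s * u' (fst z) (snd z)) -` {0<..}"
    by (rule open_prod_elim[OF opn mem])
  then have AB: "open A" "open B" "x0 \<in> A" "t0 \<in> B"
    "A \<times> B \<subseteq> (W \<times> UNIV) \<inter> (\<lambda>z. s * u' (fst z) (snd z)) -` {0<..}"
    by blast+
  obtain e where e: "e > 0" "cball t0 e \<subseteq> B"
    using AB(2,4) open_contains_cball by blast
  have AW: "A \<subseteq> W" using AB(4,5) by blast
  have incr: "v x a < v x b" if "x \<in> A" "t0 - e \<le> a" "a < b" "b \<le> t0 + e" for x a b
  proof (rule DERIV_pos_imp_increasing[OF that(3)])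
    fix t assume t: "a \<le> t" "t \<le> b"
    have "t \<in> B" using t that e(2) by (auto simp: cball_def dist_real_def subset_iff abs_le_iff)
    then have "s * u' x t > 0" using AB(5) that(1) by auto
    moreover have "(v x has_real_derivative s * u' x t) (at t)"
      unfolding v_def using deriv[of x t] AW that(1) by (intro DERIV_cmult) auto
    ultimately show "\<exists>y. DERIV (v x) t :> y \<and> 0 < y" by blast
  qed
  define W' where "W' = (A \<inter> (\<lambda>x. v x (t0 - e)) -` {..<0}) \<inter> (A \<inter> (\<lambda>x. v x (t0 + e)) -` {0<..})"
  have "open W'"
    unfolding W'_def using AB(1) continuous_on_subset[OF cv AW]
    by (intro open_Int continuous_open_preimage) auto
  have v0: "v x0 t0 = 0" by (simp add: v_def root)
  have "x0 \<in> W'"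
    using incr[OF AB(3), of "t0 - e" t0] incr[OF AB(3), of t0 "t0 + e"] e(1) v0 AB(3)
    by (auto simp: W'_def)
  define \<psi> where "\<psi> = (\<lambda>x. SOME t. t0 - e < t \<and> t < t0 + e \<and> v x t = 0)"
  have \<psi>: "t0 - e < \<psi> x \<and> \<psi> x < t0 + e \<and> v x (\<psi> x) = 0" if "x \<in> W'" for x
  proof -
    have ends: "v x (t0 - e) < 0" "v x (t0 + e) > 0" "x \<in> W"
      using that AW by (auto simp: W'_def)
    have "continuous_on {t0 - e..t0 + e} (v x)"
      unfolding v_def using deriv[OF ends(3)]
      by (intro continuous_intros) (meson DERIV_isCont continuous_at_imp_continuous_on)
    then obtain t where "t0 - e \<le> t" "t \<le> t0 + e" "v x t = 0"
      using IVT'[of "v x" "t0 - e" 0 "t0 + e"] ends e(1) by auto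
    then have "t0 - e < t \<and> t < t0 + e \<and> v x t = 0"
      using ends by (metis less_eq_real_def less_irrefl)
    then show ?thesis unfolding \<psi>_def by (rule someI)
  qed
  have W'A: "W' \<subseteq> A" by (auto simp: W'_def)
  \<comment> \<open>These equivalences reduce continuity of the root to continuity of
    \<open>v\<close> at a fixed second argument; they also force
    \<open>\<psi> x0 = t0\<close>.\<close>
  have below: "\<psi> x < a \<longleftrightarrow> v x a > 0" and above: "a < \<psi> x \<longleftrightarrow> v x a < 0"
    if "x \<in> W'" "t0 - e \<le> a" "a \<le> t0 + e" for x a
    using incr[of x a "\<psi> x"] incr[of x "\<psi> x" a] \<psi>[OF that(1)] that W'A
    by (cases a "\<psi> x" rule: linorder_cases; force)+
  have "\<psi> x0 = t0"
    using below[OF \<open>x0 \<in> W'\<close>, of t0] above[OF \<open>x0 \<in> W'\<close>, of t0] v0 e(1) by auto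
  have "continuous_on W' \<psi>"
    unfolding continuous_on_def
  proof
    fix x1 assume x1: "x1 \<in> W'"
    have lim: "((\<lambda>x. v x a) \<longlongrightarrow> v x1 a) (at x1 within W')" for a
      using cv x1 W'A AW by (meson continuous_on_def continuous_on_subset)
    have evW: "\<forall>\<^sub>F x in at x1 within W'. x \<in> W'"
      by (simp add: eventually_at_filter)
    show "(\<psi> \<longlongrightarrow> \<psi> x1) (at x1 within W')"
    proof (rule order_tendstoI)
      fix a assume "a < \<psi> x1"
      \<comment> \<open>Clipping keeps \<open>b\<close> in the interval on which monotonicity is
        known.\<close>
      define b where "b = max a (t0 - e)"
      have b: "t0 - e \<le> b" "b \<le> t0 + e" "b < \<psi> x1"
        using \<open>a < \<psi> x1\<close> \<psi>[OF x1] by (auto simp: b_def)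
      then have "v x1 b < 0" using above[OF x1] by blast
      then have "\<forall>\<^sub>F x in at x1 within W'. v x b < 0"
        using order_tendstoD(2)[OF lim] by blast
      then show "\<forall>\<^sub>F x in at x1 within W'. a < \<psi> x"
        using evW
      proof eventually_elim
        case (elim x)
        then have "b < \<psi> x" using above b by blast
        then show ?case by (simp add: b_def)
      qed
    next
      fix a assume "\<psi> x1 < a"
      define b where "b = min a (t0 + e)"
      have b: "t0 - e \<le> b" "b \<le> t0 + e" "\<psi> x1 < b"
        using \<open>\<psi> x1 < a\<close> \<psi>[OF x1] by (auto simp: b_def)
      then have "v x1 b > 0" using below[OF x1] by blast
      then have "\<forall>\<^sub>F x in at x1 within W'. v x b > 0"
        using order_tendstoD(1)[OF lim] by blast
      then show "\<forall>\<^sub>F x in at x1 within W'. \<psi> x < a"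
        using evW
      proof eventually_elim
        case (elim x)
        then have "\<psi> x < b" using below b by blast
        then show ?case by (simp add: b_def)
      qed
    qed
  qed
  moreover have "u x (\<psi> x) = 0" if "x \<in> W'" for x
    using \<psi>[OF that] s(1) by (simp add: v_def)
  ultimately show ?thesis
    using that \<open>open W'\<close> \<open>x0 \<in> W'\<close> \<open>\<psi> x0 = t0\<close> W'A AW by blast
qed

section \<open>Triangular systems and their local geometry\<close>

definition in_box :: "real \<Rightarrow> real^'n \<Rightarrow> real^'n::finite \<Rightarrow> bool" where
  "in_box e x y \<longleftrightarrow> (\<forall>i. \<bar>y $ i - x $ i\<bar> < e)"

lemma open_contains_in_box:
  fixes x :: "real^'n::finite"
  assumes "open O'" "x \<in> O'"
  obtains e where "e > 0" "\<And>y. in_box e x y \<Longrightarrow> y \<in> O'"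
proof -
  obtain r where r: "r > 0" "ball x r \<subseteq> O'"
    using assms open_contains_ball by blast
  show ?thesis
  proof
    show "r / real CARD('n) > 0" using r(1) by simp
    fix y assume y: "in_box (r / real CARD('n)) x y"
    have "norm (y - x) \<le> (\<Sum>i\<in>UNIV. \<bar>(y - x) $ i\<bar>)" by (rule norm_le_l1_cart)
    also have "\<dots> < (\<Sum>i\<in>(UNIV::'n set). r / real CARD('n))"
      using y by (intro sum_strict_mono) (auto simp: in_box_def)
    also have "\<dots> = r" by simp
    finally show "y \<in> O'" using r(2) by (auto simp: dist_norm norm_minus_commute)
  qed
qed

lemma open_in_box: "open {y. in_box e x y}"
proof -
  have "{y. in_box e x y} = (\<Inter>i. {y. \<bar>y $ i - x $ i\<bar> < e})"
    by (auto simp: in_box_def)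
  then show ?thesis
    by (auto intro!: open_Collect_less continuous_intros)
qed

text \<open>\<open>\<phi>\<close> is a section of the projection that forgets the
  \<open>J\<close>-coordinates. Its domain lies in the full space, so variables can be added to
  \<open>J\<close> without changing the type.\<close>

definition local_section :: "'n set \<Rightarrow> 'n rpoly \<Rightarrow> 'n rpoly \<Rightarrow> real^'n::finite \<Rightarrow> bool" where
  "local_section J f g x0 \<longleftrightarrow> (\<exists>W \<phi>. open W \<and> x0 \<in> W \<and> continuous_on W \<phi> \<and> \<phi> x0 = x0 \<and>
     (\<forall>x\<in>W. (\<forall>i. i \<notin> J \<longrightarrow> \<phi> x $ i = x $ i) \<and> peval f (\<phi> x) = 0 \<and> peval g (\<phi> x) \<noteq> 0))"

definition locally_determined :: "'n set \<Rightarrow> 'n set \<Rightarrow> 'n rpoly \<Rightarrow> real^'n::finite \<Rightarrow> bool" where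
  "locally_determined F J f x0 \<longleftrightarrow> (\<exists>e>0. \<forall>x y. in_box e x0 x \<longrightarrow> in_box e x0 y \<longrightarrow>
     peval f x = 0 \<longrightarrow> peval f y = 0 \<longrightarrow> (\<forall>i\<in>F. x $ i = y $ i) \<longrightarrow> (\<forall>i\<in>J. x $ i = y $ i))"

text \<open>The triangular system consists of the minimal polynomials of the variables in \<open>J\<close>,
  each over the previous ones, summed up in the single polynomial \<open>f\<close>; \<open>g\<close> is the product
  of their leading coefficients and derivatives.\<close>

definition triangular_pair :: "'n rpoly set \<Rightarrow> 'n set \<Rightarrow> 'n::finite set \<Rightarrow> 'n rpoly \<Rightarrow> 'n rpoly \<Rightarrow> bool" where
  "triangular_pair Q F J f g \<longleftrightarrow> f \<in> Q \<and> g \<notin> Q \<and> f \<in> polys_in (F \<union> J) \<and>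
     (\<forall>x. peval f x = 0 \<longrightarrow> peval g x \<noteq> 0 \<longrightarrow>
        (\<forall>p\<in>Q \<inter> polys_in (F \<union> J). peval p x = 0) \<and> local_section J f g x \<and> locally_determined F J f x)"

text \<open>Substitute the given section into \<open>H\<close> and solve for coordinate
  \<open>j\<close> by \<open>implicit_root\<close>. Over the reals the sum of squares encodes both
  equations at once.\<close>

lemma local_section_insert:
  fixes f g :: "'n::finite rpoly"
  assumes sec: "local_section J f g x0"
    and f: "f \<in> polys_in G" and j: "j \<notin> G"
    and H: "coeffs_in (polys_in G) H"
    and x0: "peval (poly H (pvar j)) x0 = 0" "peval (poly (formal_deriv H) (pvar j)) x0 \<noteq> 0" "peval g' x0 \<noteq> 0"
  shows "local_section (insert j J) (f * f + poly H (pvar j) * poly H (pvar j)) g' x0"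
proof -
  obtain W \<phi> where W: "open W" "x0 \<in> W" "continuous_on W \<phi>" "\<phi> x0 = x0"
    and \<phi>: "\<And>x i. x \<in> W \<Longrightarrow> i \<notin> J \<Longrightarrow> \<phi> x $ i = x $ i" "\<And>x. x \<in> W \<Longrightarrow> peval f (\<phi> x) = 0"
    using sec unfolding local_section_def by blast
  define u where "u = (\<lambda>x. poly (eval_coeffs (\<phi> x) H))"
  define u' where "u' = (\<lambda>x. poly (pderiv (eval_coeffs (\<phi> x) H)))"
  have u_eq: "peval (poly H (pvar j)) (vupd (\<phi> x) j t) = u x t" 
    and u'_eq: "peval (poly (formal_deriv H) (pvar j)) (vupd (\<phi> x) j t) = u' x t" for x t
  proof -
    have "eval_coeffs (vupd (\<phi> x) j t) H = eval_coeffs (\<phi> x) H"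
      using j by (intro eval_coeffs_cong[OF H]) auto
    then show "peval (poly H (pvar j)) (vupd (\<phi> x) j t) = u x t" 
      "peval (poly (formal_deriv H) (pvar j)) (vupd (\<phi> x) j t) = u' x t"
      by (simp_all add: peval_poly u_def u'_def eval_coeffs_formal_deriv)
  qed
  have comp: "continuous_on (W \<times> UNIV) (\<lambda>z. \<phi> (fst z))"
    by (rule continuous_on_compose2[OF W(3)]) (auto intro: continuous_intros)
  obtain W' \<psi> where W': "open W'" "x0 \<in> W'" "W' \<subseteq> W" "continuous_on W' \<psi>" "\<psi> x0 = x0 $ j"
    "\<And>x. x \<in> W' \<Longrightarrow> u x (\<psi> x) = 0"
  proof (rule implicit_root[OF W(1,2), of u u'])
    show "continuous_on (W \<times> UNIV) (\<lambda>z. u (fst z) (snd z))"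
      unfolding u_eq[symmetric] by (intro continuous_intros comp)
    show "continuous_on (W \<times> UNIV) (\<lambda>z. u' (fst z) (snd z))"
      unfolding u'_eq[symmetric] by (intro continuous_intros comp)
    show "(u x has_real_derivative u' x t) (at t)" for x t
      unfolding u_def u'_def by (rule poly_DERIV)
    show "u x0 (x0 $ j) = 0" "u' x0 (x0 $ j) \<noteq> 0"
      using x0 by (simp_all flip: u_eq u'_eq add: W(4))
  qed blast
  define \<phi>' where "\<phi>' = (\<lambda>x. vupd (\<phi> x) j (\<psi> x))"
  have c': "continuous_on W' \<phi>'"
    unfolding \<phi>'_def using W'(3,4) W(3) by (intro continuous_intros) (auto intro: continuous_on_subset)
  have \<phi>'0: "\<phi>' x0 = x0" by (simp add: \<phi>'_def W(4) W'(5))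
  define W2 where "W2 = W' \<inter> \<phi>' -` {x. peval g' x \<noteq> 0}"
  have "open W2"
    unfolding W2_def by (intro continuous_open_preimage c' W'(1) open_peval_neq)
  moreover have "x0 \<in> W2"
    using W'(2) x0(3) \<phi>'0 by (simp add: W2_def)
  moreover have "continuous_on W2 \<phi>'"
    using c' by (rule continuous_on_subset) (auto simp: W2_def)
  moreover have "(\<forall>i. i \<notin> insert j J \<longrightarrow> \<phi>' x $ i = x $ i) \<and>
      peval (f * f + poly H (pvar j) * poly H (pvar j)) (\<phi>' x) = 0 \<and> peval g' (\<phi>' x) \<noteq> 0"
    if x: "x \<in> W2" for x
  proof -
    have xW: "x \<in> W'" "x \<in> W" using x W'(3) by (auto simp: W2_def)
    have "peval f (\<phi>' x) = peval f (\<phi> x)"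
      using j by (intro peval_cong_on[OF f]) (auto simp: \<phi>'_def)
    moreover have "peval (poly H (pvar j)) (\<phi>' x) = 0"
      using u_eq W'(6)[OF xW(1)] by (simp add: \<phi>'_def)
    moreover have "\<phi>' x $ i = x $ i" if "i \<notin> insert j J" for i
      using that \<phi>(1)[OF xW(2)] by (simp add: \<phi>'_def)
    ultimately show ?thesis
      using \<phi>(2)[OF xW(2)] x by (simp add: W2_def)
  qed
  ultimately show ?thesis
    unfolding local_section_def using \<phi>'0 by blast
qed

text \<open>Once the \<open>J\<close>-coordinates agree, \<open>x $ j\<close> and
  \<open>y $ j\<close> are roots of the same polynomial \<open>h\<close>. Distinct roots would force
  a critical point between them, in a region where the derivative has no zero.\<close>

lemma locally_determined_insert:
  fixes f :: "'n::finite rpoly"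
  assumes det: "locally_determined F J f x0" and j: "j \<notin> F \<union> J"
    and H: "coeffs_in (polys_in (F \<union> J)) H"
    and x0: "peval (poly (formal_deriv H) (pvar j)) x0 \<noteq> 0"
  shows "locally_determined F (insert j J) (f * f + poly H (pvar j) * poly H (pvar j)) x0"
proof -
  obtain e1 where e1: "e1 > 0" "\<forall>x y. in_box e1 x0 x \<longrightarrow> in_box e1 x0 y \<longrightarrow> peval f x = 0 \<longrightarrow>
      peval f y = 0 \<longrightarrow> (\<forall>i\<in>F. x $ i = y $ i) \<longrightarrow> (\<forall>i\<in>J. x $ i = y $ i)"
    using det unfolding locally_determined_def by (elim exE conjE) (rule that)
  have "x0 \<in> {y. peval (poly (formal_deriv H) (pvar j)) y \<noteq> 0}"
    using x0 by simp
  from open_contains_in_box[OF open_peval_neq this] obtain e2 where e2: "e2 > 0"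
    "\<And>y. in_box e2 x0 y \<Longrightarrow> y \<in> {y. peval (poly (formal_deriv H) (pvar j)) y \<noteq> 0}"
    by blast
  have *: "\<forall>i\<in>insert j J. x $ i = y $ i"
    if xy: "in_box (min e1 e2) x0 x" "in_box (min e1 e2) x0 y"
      "peval (f * f + poly H (pvar j) * poly H (pvar j)) x = 0"
      "peval (f * f + poly H (pvar j) * poly H (pvar j)) y = 0" "\<forall>i\<in>F. x $ i = y $ i" for x y
  proof -
    have z: "peval f x = 0" "peval f y = 0" "peval (poly H (pvar j)) x = 0" "peval (poly H (pvar j)) y = 0"
      using xy(3,4) by (simp_all add: sum_squares_eq_zero_iff)
    have "in_box e1 x0 x" "in_box e1 x0 y"
      using xy(1,2) by (auto simp: in_box_def)
    then have J: "\<forall>i\<in>J. x $ i = y $ i"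
      using e1(2)[THEN spec, THEN spec, of x y] xy(5) z(1,2) by blast
    define h where "h = eval_coeffs x H"
    have hy: "eval_coeffs y H = h"
      unfolding h_def using J xy(5) by (intro eval_coeffs_cong[OF H]) auto
    have h: "poly h (x $ j) = 0" "poly h (y $ j) = 0"
      using z(3,4) hy by (simp_all add: peval_poly h_def)
    \<comment> \<open>The box is coordinatewise, so moving coordinate \<open>j\<close> between
      \<open>x $ j\<close> and \<open>y $ j\<close> does not leave it.\<close>
    have no_crit: "poly (pderiv h) t \<noteq> 0" if "min (x $ j) (y $ j) < t" "t < max (x $ j) (y $ j)" for t
    proof -
      have "in_box e2 x0 (vupd x j t)"
        unfolding in_box_def
      proof
        fix i
        have "\<bar>x $ i - x0 $ i\<bar> < e2" "\<bar>y $ i - x0 $ i\<bar> < e2"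
          using xy(1,2) by (auto simp: in_box_def)
        then show "\<bar>vupd x j t $ i - x0 $ i\<bar> < e2"
          using that by (cases "i = j") (auto simp: abs_less_iff min_def max_def split: if_splits)
      qed
      moreover have "eval_coeffs (vupd x j t) H = h"
        unfolding h_def using j by (intro eval_coeffs_cong[OF H]) auto
      ultimately show ?thesis
        using e2(2)[of "vupd x j t"] by (simp add: peval_poly eval_coeffs_formal_deriv)
    qed
    have "\<not> a < b" if "poly h a = 0" "poly h b = 0" "\<And>t. a < t \<Longrightarrow> t < b \<Longrightarrow> poly (pderiv h) t \<noteq> 0" for a b
      using poly_MVT[of a b h] that by auto
    then have "\<not> x $ j < y $ j" "\<not> y $ j < x $ j"
      using h no_crit by (auto simp: min_def max_def)
    then show ?thesis using J by auto
  qed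
  show ?thesis
    unfolding locally_determined_def
    by (rule exI[of _ "min e1 e2"], intro conjI allI impI *) (use e1(1) e2(1) in simp_all)
qed

text \<open>Adjoin the variables of \<open>J\<close> one at a time, each with its minimal polynomial
  over the previous subring. Separability keeps the derivative outside \<open>Q\<close>, and
  primality then keeps the product \<open>g\<close> outside.\<close>

lemma ex_triangular_pair:
  fixes F :: "'n::finite set"
  assumes Q: "is_prime_ideal Q" and alg: "algebraic_over Q F" and "F \<inter> J = {}"
    and indep: "indep_mod Q F"
  shows "\<exists>f g. triangular_pair Q F J f g"
proof -
  have "finite J" by simp
  then show ?thesis using assms(3)
  proof (induction J)
    case empty
    \<comment> \<open>The base case has \<open>f = 0\<close> and \<open>g = 1\<close>, as
      independence leaves only zero in \<open>Q \<inter> polys_in F\<close>.\<close>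
    have "locally_determined F {} 0 x" for x
      by (auto simp: locally_determined_def intro: exI[of _ 1])
    moreover have "local_section {} 0 1 x" for x :: "real^'n"
      unfolding local_section_def by (intro exI[of _ UNIV] exI[of _ "\<lambda>x. x"]) auto
    moreover have "peval p x = 0" if "p \<in> Q \<inter> polys_in F" for p x
      using that indep by (auto simp: indep_mod_def)
    ultimately have "triangular_pair Q F {} 0 1"
      using prime_idealD[OF Q] ideal_zero[of Q] subring_polys_in[of F, unfolded subring_set_def]
      by (auto simp: triangular_pair_def)
    then show ?case by blast
  next
    case (insert j J)
    define G where "G = F \<union> J"
    have j: "j \<notin> G" using insert by (auto simp: G_def)
    obtain f g where fg: "triangular_pair Q F J f g" using insert by auto
    then have fg': "f \<in> Q" "g \<notin> Q" "f \<in> polys_in G"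
      by (auto simp: triangular_pair_def G_def)
    have "algebraic_mod Q (polys_in G) (pvar j)"
      using alg algebraic_mod_mono[OF polys_in_mono[of F G]] by (auto simp: algebraic_over_def G_def)
    then obtain H where Hm: "min_poly_mod Q (polys_in G) (pvar j) H"
      using ex_min_poly_mod by blast
    note H = min_poly_modD[OF Hm] min_poly_mod_degree_pos[OF Hm]
    note Qi = prime_idealD(1)[OF Q]
    define h where "h = poly H (pvar j)"
    define f' where "f' = f * f + h * h"
    define g' where "g' = g * (lead_coeff H * poly (formal_deriv H) (pvar j))"
    have "poly (formal_deriv H) (pvar j) \<notin> Q"
      using min_poly_mod_formal_deriv[OF Q _ Hm of_nat_notin_prime[OF Q]] by simp
    then have g'Q: "g' \<notin> Q"
      using prime_idealD(2)[OF Q] fg'(2) H(3) by (auto simp: g'_def)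
    have f'Q: "f' \<in> Q"
      using Qi fg'(1) H(2) by (simp add: f'_def h_def ideal_add ideal_mult_left)
    have up: "polys_in G \<subseteq> polys_in (insert j G)" by (rule polys_in_mono) auto
    have var: "pvar j \<in> polys_in (insert j G)" by (rule polys_in.var) simp
    have "h \<in> polys_in (insert j G)"
      unfolding h_def using coeffs_in_mono[OF up H(1)] var by (intro coeffs_in_poly) auto
    then have inG: "f' \<in> polys_in (insert j G)"
      using up fg'(3) unfolding f'_def by (auto intro!: polys_in.add polys_in.mult)
    have "(\<forall>p\<in>Q \<inter> polys_in (insert j G). peval p x = 0) \<and> local_section (insert j J) f' g' x
        \<and> locally_determined F (insert j J) f' x"
      if x: "peval f' x = 0" "peval g' x \<noteq> 0" for x
    proof -
      have fh: "peval f x = 0" "peval h x = 0"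
        using x(1) by (simp_all add: f'_def sum_squares_eq_zero_iff)
      have gx: "peval g x \<noteq> 0" "peval (lead_coeff H) x \<noteq> 0" "peval (poly (formal_deriv H) (pvar j)) x \<noteq> 0"
        using x(2) by (auto simp: g'_def)
      have IH: "\<forall>p\<in>Q \<inter> polys_in G. peval p x = 0" "local_section J f g x" "locally_determined F J f x"
        using fg fh(1) gx(1) by (auto simp: triangular_pair_def G_def)
      \<comment> \<open>After multiplication by a power of the leading coefficient, \<open>p\<close>
        reduces to a remainder of smaller degree than the minimal polynomial. Its coefficients lie
        in \<open>Q\<close> and vanish at \<open>x\<close> by induction, and the leading coefficient
        does not vanish there.\<close>
      have "peval p x = 0" if "p \<in> Q" "p \<in> polys_in (insert j G)" for p
      proof -
        obtain P where P: "coeffs_in (polys_in G) P" "p = poly P (pvar j)"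
          using polys_in_insert[OF \<open>p \<in> polys_in (insert j G)\<close>] by blast
        obtain N B R where d: "coeffs_in (polys_in G) R"
          "smult (lead_coeff H ^ N) P = H * B + R" "degree R < degree H"
          using pseudo_division_over[OF subring_polys_in H(1,5) P(1)] by blast
        have eq: "lead_coeff H ^ N * p = h * poly B (pvar j) + poly R (pvar j)"
          using arg_cong[OF d(2), of "\<lambda>H. poly H (pvar j)"] by (simp add: P(2) h_def)
        have "lead_coeff H ^ N * p - h * poly B (pvar j) \<in> Q"
          using Qi H(2) \<open>p \<in> Q\<close> by (simp add: h_def ideal_minus ideal_mult_left ideal_mult_right)
        then have "poly R (pvar j) \<in> Q" using eq by simp
        then have "coeff R i \<in> Q" for i
          using min_poly_mod_lower_degree[OF Qi subring_polys_in Hm d(1) _ d(3)] by blast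
        then have "peval (coeff R i) x = 0" for i
          using IH(1) d(1) by (auto simp: coeffs_in_def)
        then have "eval_coeffs x R = 0"
          by (intro poly_eqI) (simp add: coeff_map_poly)
        then have "peval (lead_coeff H) x ^ N * peval p x = 0"
          using arg_cong[OF eq, of "\<lambda>q. peval q x"] fh(2) by (simp add: peval_poly[of R])
        then show ?thesis using gx(2) by simp
      qed
      moreover have "local_section (insert j J) f' g' x"
        unfolding f'_def h_def using fh(2) gx(3) x(2)
        by (intro local_section_insert[OF IH(2) fg'(3) j H(1)]) (auto simp: h_def)
      moreover have "locally_determined F (insert j J) f' x"
        unfolding f'_def h_def using gx(3) j H(1)
        by (intro locally_determined_insert[OF IH(3)]) (auto simp: G_def)
      ultimately show ?thesis by blast
    qed
    then have "triangular_pair Q F (insert j J) f' g'"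
      using f'Q g'Q inG by (auto simp: triangular_pair_def G_def)
    then show ?case by blast
  qed
qed

section \<open>Generic prime ideals and chains\<close>

text \<open>By Zorn's lemma \<open>Q\<close> is maximal among the ideals above \<open>I\<close> that
  avoid \<open>W\<close>. The third conclusion expresses this maximality by elements and drives
  \<open>generic_prime\<close>.\<close>

lemma prime_ideal_avoiding:
  fixes I :: "'a::comm_ring_1 set"
  assumes I: "is_ideal I" "I \<inter> W = {}" and W: "1 \<in> W" "\<And>a b. a \<in> W \<Longrightarrow> b \<in> W \<Longrightarrow> a * b \<in> W"
  obtains Q where "is_prime_ideal Q" "I \<subseteq> Q" "\<And>g. g \<notin> Q \<Longrightarrow> \<exists>j\<in>Q. \<exists>r. j + r * g \<in> W" "Q \<inter> W = {}"
proof -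
  define A where "A = {J. is_ideal J \<and> I \<subseteq> J \<and> J \<inter> W = {}}"
  have "\<Union>C \<in> A" if C: "C \<noteq> {}" "subset.chain A C" for C
  proof -
    have CA: "\<And>J. J \<in> C \<Longrightarrow> is_ideal J \<and> I \<subseteq> J \<and> J \<inter> W = {}"
      using C(2) by (auto simp: subset.chain_def A_def)
    have "a + b \<in> \<Union>C" if "a \<in> J" "J \<in> C" "b \<in> K" "K \<in> C" for a b J K
    proof -
      have "J \<subseteq> K \<or> K \<subseteq> J"
        using C(2) that by (auto simp: subset_chain_def)
      then show ?thesis
        using that CA ideal_add[of J a b] ideal_add[of K a b] by blast
    qed
    moreover have "r * a \<in> \<Union>C" if "a \<in> \<Union>C" for r a
      using that CA ideal_mult_left by blast
    moreover obtain J where J: "J \<in> C" using C(1) by blast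
    moreover have "0 \<in> \<Union>C" "I \<subseteq> \<Union>C"
      using J CA[OF J] ideal_zero by blast+
    ultimately have "is_ideal (\<Union>C)"
      by (simp add: is_ideal_def)
    then show ?thesis
      using \<open>I \<subseteq> \<Union>C\<close> CA unfolding A_def by blast
  qed
  moreover have "A \<noteq> {}" using I by (auto simp: A_def)
  ultimately obtain Q where Q: "Q \<in> A" and max: "\<And>J. J \<in> A \<Longrightarrow> Q \<subseteq> J \<Longrightarrow> J = Q"
    using subset_Zorn_nonempty[of A] by blast
  have Qi: "is_ideal Q" "I \<subseteq> Q" "Q \<inter> W = {}" using Q by (auto simp: A_def)
  have hit: "\<exists>j\<in>Q. \<exists>r. j + r * g \<in> W" if "g \<notin> Q" for g
  proof (rule ccontr)
    assume no: "\<not> ?thesis"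
    define J where "J = {j + r * g |j r. j \<in> Q}"
    have "is_ideal J"
      unfolding is_ideal_def
    proof (intro conjI ballI allI)
      have "0 = 0 + 0 * g" by simp
      then show "0 \<in> J" unfolding J_def using ideal_zero[OF Qi(1)] by blast
    next
      fix a b assume "a \<in> J" "b \<in> J"
      then obtain j r k s where "a = j + r * g" "b = k + s * g" "j \<in> Q" "k \<in> Q"
        unfolding J_def by blast
      then have "a + b = (j + k) + (r + s) * g" "j + k \<in> Q"
        using ideal_add[OF Qi(1)] by (auto simp: algebra_simps)
      then show "a + b \<in> J" unfolding J_def by blast
    next
      fix s a assume "a \<in> J"
      then obtain j r where "a = j + r * g" "j \<in> Q" unfolding J_def by blast
      then have "s * a = s * j + (s * r) * g" "s * j \<in> Q"
        using ideal_mult_left[OF Qi(1)] by (auto simp: algebra_simps)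
      then show "s * a \<in> J" unfolding J_def by blast
    qed
    moreover have "Q \<subseteq> J"
    proof
      fix q assume "q \<in> Q"
      then have "q = q + 0 * g" "q \<in> Q" by auto
      then show "q \<in> J" unfolding J_def by blast
    qed
    moreover have "J \<inter> W = {}" using no unfolding J_def by blast
    ultimately have "J = Q" using max Qi(2) unfolding A_def by blast
    moreover have "0 + 1 * g \<in> J" unfolding J_def using ideal_zero[OF Qi(1)] by blast
    ultimately show False using that by simp
  qed
  have "is_prime_ideal Q"
    unfolding is_prime_ideal_def
  proof (intro conjI allI impI Qi(1))
    show "Q \<noteq> UNIV" using Qi(3) W(1) by blast
    fix a b assume ab: "a * b \<in> Q"
    show "a \<in> Q \<or> b \<in> Q"
    proof (rule ccontr)
      assume "\<not> ?thesis"
      then obtain j r k s where *: "j \<in> Q" "k \<in> Q" "j + r * a \<in> W" "k + s * b \<in> W"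
        using hit by blast
      have "(j + r * a) * (k + s * b) = j * (k + s * b) + (r * a) * k + (r * s) * (a * b)"
        by (simp add: algebra_simps)
      moreover have "j * (k + s * b) \<in> Q" "(r * a) * k \<in> Q" "(r * s) * (a * b) \<in> Q"
        using ideal_mult_right[OF Qi(1) *(1)] ideal_mult_left[OF Qi(1) *(2)] ideal_mult_left[OF Qi(1) ab]
        by blast+
      ultimately have "(j + r * a) * (k + s * b) \<in> Q"
        using ideal_add[OF Qi(1)] by metis
      then show False using W(2)[OF *(3,4)] Qi(3) by blast
    qed
  qed
  then show ?thesis using that hit Qi by blast
qed

lemma ideal_vanishing_ideal: "is_ideal (vanishing_ideal A)"
  by (auto simp: is_ideal_def vanishing_ideal_def)

text \<open>As ideals here are finitely generated and sums of squares combine the generators, this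
  says that \<open>Q\<close> is the vanishing ideal of its real zero set. Testing a single
  \<open>p\<close> at a time avoids generators.\<close>

definition real_prime :: "'n::finite rpoly set \<Rightarrow> bool" where
  "real_prime Q \<longleftrightarrow> is_prime_ideal Q \<and> (\<forall>p\<in>Q. \<forall>g. g \<notin> Q \<longrightarrow> (\<exists>x. peval p x = 0 \<and> peval g x \<noteq> 0))"

text \<open>Nonvanishing sets are relatively open, so intersecting dense ones preserves density and
  \<open>W\<close> is multiplicative. An element of \<open>Q\<close> lies outside \<open>W\<close>,
  hence vanishes on a nonempty relatively open piece of \<open>U\<close>.\<close>

lemma generic_prime:
  fixes U :: "(real^'n::finite) set"
  assumes "U \<noteq> {}"
  obtains Q where "real_prime Q" "vanishing_ideal U \<subseteq> Q"
    "\<And>p g. p \<in> Q \<Longrightarrow> g \<notin> Q \<Longrightarrow>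
       \<exists>O'. open O' \<and> O' \<inter> U \<noteq> {} \<and> (\<forall>x\<in>O' \<inter> U. peval p x = 0 \<and> peval g x \<noteq> 0)"
proof -
  define W where "W = {p. \<forall>O'. open O' \<and> O' \<inter> U \<noteq> {} \<longrightarrow> (\<exists>x\<in>O' \<inter> U. peval p x \<noteq> 0)}"
  have W1: "1 \<in> W" by (auto simp: W_def)
  have Wmult: "a * b \<in> W" if "a \<in> W" "b \<in> W" for a b
    unfolding W_def
  proof (intro CollectI allI impI)
    fix O' assume O': "open O' \<and> O' \<inter> U \<noteq> {}"
    then have "\<exists>x\<in>O' \<inter> U. peval a x \<noteq> 0" using that(1) unfolding W_def by blast
    then have "open (O' \<inter> {x. peval a x \<noteq> 0}) \<and> (O' \<inter> {x. peval a x \<noteq> 0}) \<inter> U \<noteq> {}"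
      using O' open_peval_neq by (auto intro!: open_Int)
    then have "\<exists>x\<in>(O' \<inter> {x. peval a x \<noteq> 0}) \<inter> U. peval b x \<noteq> 0"
      using that(2) unfolding W_def by blast
    then show "\<exists>x\<in>O' \<inter> U. peval (a * b) x \<noteq> 0" by auto
  qed
  have "vanishing_ideal U \<inter> W = {}"
  proof -
    have "p \<notin> W" if "p \<in> vanishing_ideal U" for p
      using that assms unfolding W_def vanishing_ideal_def by (auto intro!: exI[of _ UNIV])
    then show ?thesis by blast
  qed
  from prime_ideal_avoiding[OF ideal_vanishing_ideal this W1 Wmult]
  obtain Q where Q: "is_prime_ideal Q" "vanishing_ideal U \<subseteq> Q"
    "\<And>g. g \<notin> Q \<Longrightarrow> \<exists>j\<in>Q. \<exists>r. j + r * g \<in> W" "Q \<inter> W = {}" by blast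
  have gen: "\<exists>O'. open O' \<and> O' \<inter> U \<noteq> {} \<and> (\<forall>x\<in>O' \<inter> U. peval p x = 0 \<and> peval g x \<noteq> 0)"
    if pg: "p \<in> Q" "g \<notin> Q" for p g
  proof -
    obtain j r where j: "j \<in> Q" "j + r * g \<in> W" using Q(3) pg(2) by blast
    \<comment> \<open>Being outside \<open>W\<close>, this sum vanishes on a relatively open piece,
      where \<open>p\<close> and \<open>j\<close> then both vanish. So wherever
      \<open>j + r * g\<close> is nonzero on that piece, \<open>g\<close> is nonzero as
      well.\<close>
    have "p * p + j * j \<in> Q"
      using prime_idealD(1)[OF Q(1)] pg(1) j(1) by (simp add: ideal_add ideal_mult_left)
    then have "p * p + j * j \<notin> W" using Q(4) by blast
    then obtain O' where O': "open O'" "O' \<inter> U \<noteq> {}" "\<forall>x\<in>O' \<inter> U. peval (p * p + j * j) x = 0"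
      unfolding W_def by blast
    then have z: "peval p x = 0 \<and> peval j x = 0" if "x \<in> O' \<inter> U" for x
      using that by (simp add: sum_squares_eq_zero_iff)
    let ?O = "O' \<inter> {x. peval (j + r * g) x \<noteq> 0}"
    have "open ?O" using O'(1) open_peval_neq by (rule open_Int)
    moreover have "?O \<inter> U \<noteq> {}"
      using j(2) O'(1,2) unfolding W_def by blast
    moreover have "\<forall>x\<in>?O \<inter> U. peval p x = 0 \<and> peval g x \<noteq> 0"
      using z by auto
    ultimately show ?thesis by blast
  qed
  then have "real_prime Q"
    using Q(1) unfolding real_prime_def by blast
  then show ?thesis using that Q(2) gen by blast
qed

lemma triangular_pair_UNIV:
  assumes "triangular_pair Q F (- F) f g"
  shows "f \<in> Q" "g \<notin> Q"
    and "peval f x = 0 \<Longrightarrow> peval g x \<noteq> 0 \<Longrightarrow> x \<in> zero_set Q"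
    and "peval f x = 0 \<Longrightarrow> peval g x \<noteq> 0 \<Longrightarrow> local_section (- F) f g x"
    and "peval f x = 0 \<Longrightarrow> peval g x \<noteq> 0 \<Longrightarrow> locally_determined F (- F) f x"
  using assms by (auto simp: triangular_pair_def zero_set_def Compl_partition)

text \<open>Slicing the zero set of \<open>Q\<close> by \<open>x\<^sub>i = c\<close> near a generic point and passing to a generic prime
  of the slice costs exactly one independent variable.\<close>

lemma real_prime_chain:
  fixes Q :: "'n::finite rpoly set"
  assumes "real_prime Q" "indep_mod Q G"
  shows "\<exists>Qs. length Qs = Suc (card G) \<and> prime_chain Qs \<and> hd Qs = Q"
proof -
  have "finite G" by simp
  then show ?thesis using assms
  proof (induction G arbitrary: Q)
    case empty
    then show ?case by (intro exI[of _ "[Q]"]) (auto simp: prime_chain_def real_prime_def)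
  next
    case (insert i G)
    have Q: "is_prime_ideal Q" using insert.prems(1) by (simp add: real_prime_def)
    obtain F where F: "insert i G \<subseteq> F" "indep_mod Q F" "algebraic_over Q F"
      using extend_indep_mod[OF Q insert.prems(2)] by blast
    obtain f g where fg: "triangular_pair Q F (- F) f g"
      using ex_triangular_pair[OF Q F(3) _ F(2)] by blast
    note tri = triangular_pair_UNIV[OF fg]
    obtain x0 where x0: "peval f x0 = 0" "peval g x0 \<noteq> 0"
      using insert.prems(1) tri(1,2) unfolding real_prime_def by blast
    from tri(4)[OF x0] obtain W \<phi> where W: "open W" "x0 \<in> W" "continuous_on W \<phi>"
      and \<phi>: "\<And>x k. x \<in> W \<Longrightarrow> k \<in> F \<Longrightarrow> \<phi> x $ k = x $ k"
        "\<And>x. x \<in> W \<Longrightarrow> peval f (\<phi> x) = 0 \<and> peval g (\<phi> x) \<noteq> 0"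
      unfolding local_section_def by blast
    define c where "c = x0 $ i"
    \<comment> \<open>The slice is parametrized by the section, which fixes the
      \<open>F\<close>-coordinates and stays in the zero set of \<open>Q\<close>.\<close>
    define N where "N = \<phi> ` {x \<in> W. x $ i = c}"
    have iF: "i \<in> F" using F(1) by blast
    have "N \<noteq> {}" using W(2) by (auto simp: N_def c_def)
    then obtain Q' where Q': "real_prime Q'" "vanishing_ideal N \<subseteq> Q'"
      and gen: "\<And>p g. p \<in> Q' \<Longrightarrow> g \<notin> Q' \<Longrightarrow>
       \<exists>O'. open O' \<and> O' \<inter> N \<noteq> {} \<and> (\<forall>x\<in>O' \<inter> N. peval p x = 0 \<and> peval g x \<noteq> 0)"
      using generic_prime by metis
    have Q'p: "is_prime_ideal Q'" using Q'(1) by (simp add: real_prime_def)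
    have "\<phi> x \<in> zero_set Q" if "x \<in> W" for x
      using tri(3)[of "\<phi> x"] \<phi>(2)[OF that] by blast
    then have "Q \<subseteq> vanishing_ideal N"
      unfolding vanishing_ideal_def N_def zero_set_def by blast
    then have sub: "Q \<subseteq> Q'" using Q'(2) by blast
    \<comment> \<open>The hyperplane makes the inclusion strict: its equation holds on the slice,
      but in \<open>Q\<close> it would be a relation among the independent variables
      \<open>F\<close>.\<close>
    define l where "l = pvar i - pconst c"
    have "l \<in> vanishing_ideal N"
      using \<phi>(1) iF by (auto simp: l_def vanishing_ideal_def N_def)
    moreover have "l \<notin> Q"
    proof
      assume "l \<in> Q"
      moreover have "pvar i \<in> polys_in F" using iF by (rule polys_in.var)
      moreover have "pconst c \<in> polys_in F" by (rule polys_in.const)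
      ultimately have "l \<in> polys_in F \<inter> Q"
        using subring_polys_in[of F] by (simp add: l_def subring_set_def)
      then have "l = 0"
        using F(2) unfolding indep_mod_def by blast
      then have "peval l (vec (c + 1)) = 0" by simp
      then show False by (simp add: l_def)
    qed
    ultimately have strict: "Q \<subset> Q'" using sub Q'(2) by blast
    have "indep_mod Q' G"
      unfolding indep_mod_def
    proof
      fix q assume q: "q \<in> polys_in G \<inter> Q'"
      then obtain O' where O': "open O'" "O' \<inter> N \<noteq> {}" "\<forall>x\<in>O' \<inter> N. peval q x = 0"
        using gen[of q 1] prime_idealD(3)[OF Q'p] by blast
      obtain x1 where x1: "x1 \<in> W" "x1 $ i = c" "\<phi> x1 \<in> O'"
        using O'(2) by (auto simp: N_def)
      \<comment> \<open>Setting coordinate \<open>i\<close> to \<open>c\<close> before applying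
        \<open>\<phi>\<close> pulls the piece of the slice back to an open set. The
        \<open>G\<close>-coordinates are unchanged, because \<open>i\<close> is not in
        \<open>G\<close> and \<open>\<phi>\<close> fixes \<open>F\<close>, so \<open>q\<close>
        vanishes on that open set.\<close>
      let ?T = "(\<lambda>y. vupd y i c) -` (W \<inter> \<phi> -` O')"
      have "open ?T"
        using W(1,3) O'(1)
        by (intro open_vimage continuous_open_preimage continuous_intros)
      moreover have "x1 \<in> ?T"
        using x1 vupd_self[of x1 i] by simp
      moreover have "peval q y = 0" if "y \<in> ?T" for y
      proof -
        have yW: "vupd y i c \<in> W" "\<phi> (vupd y i c) \<in> O'" using that by auto
        have "y $ k = \<phi> (vupd y i c) $ k" if "k \<in> G" for k
          using that \<phi>(1)[OF yW(1)] F(1) insert.hyps(2) by auto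
        then have "peval q y = peval q (\<phi> (vupd y i c))"
          using q by (intro peval_cong_on[of q G]) auto
        moreover have "\<phi> (vupd y i c) \<in> N"
          unfolding N_def using yW(1) by simp
        ultimately show ?thesis using O'(3) yW(2) by auto
      qed
      ultimately show "q \<in> {0}"
        using polys_in_vanish_open[of q G ?T] q by blast
    qed
    from insert.IH[OF Q'(1) this] obtain Qs where Qs: "length Qs = Suc (card G)" "prime_chain Qs" "hd Qs = Q'"
      by blast
    then obtain Rs where Rs: "Qs = Q' # Rs" by (cases Qs) auto
    have "prime_chain (Q # Qs)"
      using Qs(2) Q strict unfolding prime_chain_def Rs by auto
    then show ?case
      using Qs(1) insert.hyps by (intro exI[of _ "Q # Qs"]) auto
  qed
qed

section \<open>Manifolds in real zero sets\<close>

lemma Euclidean_space_eq_euclid: "Euclidean_space d = top_of_set (euclid d)"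
  by (simp add: Euclidean_space_def euclid_def euclidean_product_topology)

text \<open>If \<open>e < d\<close>, invariance of domain would make the image open in the larger
  space \<open>euclid d\<close>, yet its points have no freedom in the coordinate of index
  \<open>e\<close>.\<close>

lemma inj_into_euclid_dim_le:
  fixes h :: "(nat \<Rightarrow> real) \<Rightarrow> nat \<Rightarrow> real"
  assumes V: "openin (top_of_set (euclid d)) V" "V \<noteq> {}"
    and h: "continuous_on V h" "h ` V \<subseteq> euclid e" "inj_on h V"
  shows "d \<le> e"
proof (rule ccontr)
  assume "\<not> d \<le> e"
  then have ed: "e < d" by simp
  have "euclid e \<subseteq> euclid d" using ed by (auto simp: euclid_def)
  then have hd: "h ` V \<subseteq> euclid d" using h(2) by blast
  have Vd: "V \<subseteq> euclid d" using V(1) openin_imp_subset by blast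
  have "continuous_map (subtopology (Euclidean_space d) V) (Euclidean_space d) h"
    using h(1) hd Vd unfolding Euclidean_space_eq_euclid
    by (simp add: subtopology_subtopology Int_absorb1 continuous_map_in_subtopology image_subset_iff_funcset)
  then have "openin (top_of_set (euclid d)) (h ` V)"
    using invariance_of_domain_Euclidean_space[of d V h] V(1) h(3) by (simp add: Euclidean_space_eq_euclid)
  then obtain T where T: "open T" "h ` V = euclid d \<inter> T"
    by (auto simp: openin_open)
  obtain y where y: "y \<in> h ` V" using V(2) by blast
  have ye: "y e = 0" using y h(2) by (auto simp: euclid_def)
  \<comment> \<open>Indices start at 0, so \<open>e\<close> is the first coordinate that is zero on
    \<open>euclid e\<close>, and it is free on \<open>euclid d\<close> as
    \<open>e < d\<close>.\<close>
  let ?S = "(\<lambda>t. y(e := t)) -` T"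
  have "continuous_on UNIV (\<lambda>t. (y(e := t)) k)" for k
    by (cases "k = e") auto
  then have "continuous_on UNIV (\<lambda>t. y(e := t))"
    by (rule continuous_on_coordinatewise_then_product)
  then have "open ?S"
    using T(1) by (metis open_vimage)
  moreover have "0 \<in> ?S"
    using y T(2) fun_upd_idem[of y e 0] ye by auto
  ultimately have "infinite ?S"
    using finite_imp_not_open by blast
  then obtain t where t: "t \<in> ?S" "t \<noteq> 0"
    by (metis finite.emptyI finite.insertI finite_subset insertCI subsetI)
  have "y(e := t) \<in> euclid d"
    using y hd ed by (auto simp: euclid_def)
  then have "y(e := t) \<in> h ` V" using T(2) t(1) by auto
  then have "y(e := t) \<in> euclid e" using h(2) by blast
  then have "(y(e := t)) e = 0" unfolding euclid_def by blast
  then show False using t(2) by simp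
qed

definition coords :: "(nat \<Rightarrow> 'n) \<Rightarrow> nat \<Rightarrow> real^'n::finite \<Rightarrow> nat \<Rightarrow> real" where
  "coords b e x = (\<lambda>k. if k < e then x $ b k else 0)"

lemma coords_in_euclid [simp]: "coords b e x \<in> euclid e"
  by (simp add: coords_def euclid_def)

lemma continuous_on_coords: "continuous_on S (coords b e)"
proof (rule continuous_on_coordinatewise_then_product)
  show "continuous_on S (\<lambda>x. coords b e x k)" for k
    by (cases "k < e") (auto simp: coords_def intro: continuous_intros)
qed

text \<open>\<open>Q\<close> is a generic prime of a chart domain. Near a generic point the
  projection to the \<open>F\<close>-coordinates is injective on that domain; composed with the
  chart it injects an open subset of \<open>euclid d\<close> into
  \<open>euclid (card F)\<close>.\<close>

lemma manifold_dim_le_indep: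
  fixes M :: "(real^'n::finite) set"
  assumes "is_manifold d M" "M \<noteq> {}"
  obtains Q F where "real_prime Q" "vanishing_ideal M \<subseteq> Q" "indep_mod Q F" "d \<le> card F"
proof -
  obtain x where "x \<in> M" using assms(2) by blast
  then obtain U V where UV: "openin (top_of_set M) U" "x \<in> U"
    "openin (top_of_set (euclid d)) V" "U homeomorphic V"
    using assms(1) unfolding is_manifold_def by blast
  obtain k k' where k: "homeomorphism V U k k'"
    using UV(4) homeomorphic_sym homeomorphic_def by metis
  have UM: "U \<subseteq> M" using UV(1) openin_imp_subset by blast
  have "U \<noteq> {}" using UV(2) by blast
  then obtain Q where Q: "real_prime Q" "vanishing_ideal U \<subseteq> Q"
    and gen: "\<And>p g. p \<in> Q \<Longrightarrow> g \<notin> Q \<Longrightarrow>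
       \<exists>O'. open O' \<and> O' \<inter> U \<noteq> {} \<and> (\<forall>x\<in>O' \<inter> U. peval p x = 0 \<and> peval g x \<noteq> 0)"
    using generic_prime by metis
  have Qp: "is_prime_ideal Q" using Q(1) by (simp add: real_prime_def)
  obtain F where F: "indep_mod Q F" "algebraic_over Q F"
    using extend_indep_mod[OF Qp indep_mod_empty[OF Qp]] by blast
  obtain f g where fg: "triangular_pair Q F (- F) f g"
    using ex_triangular_pair[OF Qp F(2) _ F(1)] by blast
  note tri = triangular_pair_UNIV[OF fg]
  obtain O' where O': "open O'" "O' \<inter> U \<noteq> {}" "\<forall>x\<in>O' \<inter> U. peval f x = 0 \<and> peval g x \<noteq> 0"
    using gen[OF tri(1,2)] by blast
  obtain y where y: "y \<in> O'" "y \<in> U" using O'(2) by blast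
  then have "locally_determined F (- F) f y"
    using O'(3) tri(5) by blast
  then obtain e where e: "e > 0" "\<forall>x z. in_box e y x \<longrightarrow> in_box e y z \<longrightarrow>
     peval f x = 0 \<longrightarrow> peval f z = 0 \<longrightarrow> (\<forall>i\<in>F. x $ i = z $ i) \<longrightarrow> (\<forall>i\<in>- F. x $ i = z $ i)"
    unfolding locally_determined_def by (elim exE conjE) (rule that)
  define B where "B = O' \<inter> {z. in_box e y z}"
  have B: "open B" unfolding B_def using O'(1) open_in_box by (rule open_Int)
  have kV: "continuous_on V k" "k ` V = U" "inj_on k V"
    using k by (auto simp: homeomorphism_def intro: inj_on_inverseI)
  define V' where "V' = V \<inter> k -` B"
  have "openin (top_of_set V) V'"
    unfolding V'_def by (rule continuous_openin_preimage_gen[OF kV(1) B])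
  then have V'o: "openin (top_of_set (euclid d)) V'"
    using UV(3) openin_trans by blast
  have "y \<in> B" using y(1) e(1) by (simp add: B_def in_box_def)
  then have V'ne: "V' \<noteq> {}" using y(2) kV(2) by (auto simp: V'_def)
  obtain b where b: "bij_betw b {..<card F} F"
    using ex_bij_betw_nat_finite[of F] by (auto simp: atLeast0LessThan)
  have "d \<le> card F"
  proof (rule inj_into_euclid_dim_le[OF V'o V'ne])
    show "continuous_on V' (\<lambda>v. coords b (card F) (k v))"
      by (rule continuous_on_compose2[OF continuous_on_coords[of UNIV] continuous_on_subset[OF kV(1)]])
        (auto simp: V'_def)
    show "(\<lambda>v. coords b (card F) (k v)) ` V' \<subseteq> euclid (card F)" by auto
    show "inj_on (\<lambda>v. coords b (card F) (k v)) V'"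
    proof (rule inj_onI)
      fix v w assume vw: "v \<in> V'" "w \<in> V'" "coords b (card F) (k v) = coords b (card F) (k w)"
      have onF: "\<forall>i\<in>F. k v $ i = k w $ i"
      proof
        fix i assume "i \<in> F"
        then obtain m where "m < card F" "i = b m"
          using b by (auto simp: bij_betw_def)
        then show "k v $ i = k w $ i"
          using fun_cong[OF vw(3), of m] by (simp add: coords_def)
      qed
      have "in_box e y (k v)" "in_box e y (k w)" "k v \<in> O' \<inter> U" "k w \<in> O' \<inter> U"
        using vw(1,2) kV(2) by (auto simp: V'_def B_def)
      then have "\<forall>i\<in>- F. k v $ i = k w $ i"
        using e(2)[THEN spec, THEN spec, of "k v" "k w"] onF O'(3) by blast
      then have "k v = k w" using onF by (auto simp: vec_eq_iff)
      then show "v = w" using kV(3) vw(1,2) by (auto simp: V'_def inj_on_def)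
    qed
  qed
  moreover have "vanishing_ideal M \<subseteq> Q"
    using Q(2) UM by (auto simp: vanishing_ideal_def)
  ultimately show ?thesis using that Q(1) F(1) by blast
qed

text \<open>As \<open>g\<close> is outside \<open>P\<close>, some point of the zero set in
  \<open>O'\<close> has \<open>g\<close> nonzero. The section through it traces a graph over an open
  set of \<open>F\<close>-coordinates, covered by a single chart.\<close>

lemma ex_manifold_of_indep_dim:
  fixes P :: "'n::finite rpoly set"
  assumes P: "is_prime_ideal P" and F: "indep_mod P F" "algebraic_over P F"
    and O': "open O'" "vanishing_ideal (zero_set P \<inter> O') = P"
  shows "\<exists>M. M \<subseteq> zero_set P \<inter> O' \<and> M \<noteq> {} \<and> is_manifold (card F) M"
proof -
  obtain f g where fg: "triangular_pair P F (- F) f g"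
    using ex_triangular_pair[OF P F(2) _ F(1)] by blast
  note tri = triangular_pair_UNIV[OF fg]
  have "g \<notin> vanishing_ideal (zero_set P \<inter> O')" using tri(2) O'(2) by simp
  then obtain x0 where x0: "x0 \<in> zero_set P" "x0 \<in> O'" "peval g x0 \<noteq> 0"
    by (auto simp: vanishing_ideal_def)
  have "peval f x0 = 0" using tri(1) x0(1) by (simp add: zero_set_def)
  from tri(4)[OF this x0(3)] obtain W \<phi> where W: "open W" "x0 \<in> W" "continuous_on W \<phi>" "\<phi> x0 = x0"
      and \<phi>: "\<And>x k. x \<in> W \<Longrightarrow> k \<in> F \<Longrightarrow> \<phi> x $ k = x $ k"
        "\<And>x. x \<in> W \<Longrightarrow> peval f (\<phi> x) = 0 \<and> peval g (\<phi> x) \<noteq> 0"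
    unfolding local_section_def by blast
  define W1 where "W1 = W \<inter> \<phi> -` O'"
  have W1: "open W1" unfolding W1_def by (rule continuous_open_preimage[OF W(3,1) O'(1)])
  define e where "e = card F"
  obtain b where b: "bij_betw b {..<e} F"
    using ex_bij_betw_nat_finite[of F] by (auto simp: atLeast0LessThan e_def)
  define b' where "b' = inv_into {..<e} b"
  have b': "b' (b k) = k" "b k \<in> F" if "k < e" for k
    using b that by (auto simp: b'_def bij_betw_def)
  have bb': "b (b' i) = i" "b' i < e" if "i \<in> F" for i
    using b that by (auto simp: b'_def bij_betw_def f_inv_into_f dest: inv_into_into)
  \<comment> \<open>The coordinates outside \<open>F\<close> are frozen at those of
    \<open>x0\<close>, which turns the section into a map on part of \<open>euclid e\<close>;
    reading off the \<open>F\<close>-coordinates inverts it.\<close>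
  define \<sigma> where "\<sigma> = (\<lambda>v. (\<chi> i. if i \<in> F then v (b' i) else x0 $ i) :: real^'n)"
  have c\<sigma>: "continuous_on UNIV \<sigma>"
  proof -
    have "continuous_on UNIV (\<lambda>v. if i \<in> F then v (b' i) else x0 $ i)" for i
      by (cases "i \<in> F") (auto intro: continuous_on_product_coordinates)
    then show ?thesis unfolding \<sigma>_def by (intro continuous_on_vec_lambda) auto
  qed
  define V where "V = euclid e \<inter> \<sigma> -` W1"
  have Vo: "openin (top_of_set (euclid e)) V"
    unfolding V_def using W1 c\<sigma> by (intro openin_open_Int) (metis open_vimage)
  define M where "M = (\<lambda>v. \<phi> (\<sigma> v)) ` V"
  have inv: "coords b e (\<phi> (\<sigma> v)) = v" if "v \<in> V" for v
  proof
    fix k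
    show "coords b e (\<phi> (\<sigma> v)) k = v k"
      using that \<phi>(1)[of "\<sigma> v" "b k"] b'[of k]
      by (cases "k < e") (auto simp: coords_def V_def W1_def \<sigma>_def euclid_def)
  qed
  have "continuous_on V (\<lambda>v. \<phi> (\<sigma> v))"
    by (rule continuous_on_compose2[OF W(3) continuous_on_subset[OF c\<sigma>]]) (auto simp: V_def W1_def)
  then have "homeomorphism V M (\<lambda>v. \<phi> (\<sigma> v)) (coords b e)"
    unfolding homeomorphism_def M_def using inv continuous_on_coords by (auto simp: image_image)
  then have "M homeomorphic V"
    using homeomorphic_def homeomorphic_sym by blast
  then have man: "is_manifold e M"
    unfolding is_manifold_def using Vo by (metis openin_subtopology_self)
  have "\<sigma> (coords b e x0) = x0"
    using bb' by (simp add: \<sigma>_def coords_def vec_eq_iff)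
  then have "coords b e x0 \<in> V"
    using W(2,4) x0(2) by (simp add: V_def W1_def)
  then have "M \<noteq> {}" unfolding M_def by blast
  moreover have "M \<subseteq> zero_set P \<inter> O'"
    using \<phi>(2) tri(3) by (auto simp: M_def V_def W1_def)
  ultimately show ?thesis using man unfolding e_def by blast
qed

section \<open>Semialgebraic subsets of a zero set\<close>

lemma subset_vanishing_ideal_zero_set: "A \<subseteq> zero_set P \<Longrightarrow> P \<subseteq> vanishing_ideal A"
  by (auto simp: vanishing_ideal_def zero_set_def)

lemma vanishing_ideal_antimono: "A \<subseteq> B \<Longrightarrow> vanishing_ideal B \<subseteq> vanishing_ideal A"
  by (auto simp: vanishing_ideal_def)

lemma vanishing_ideal_UN: "vanishing_ideal (\<Union>x\<in>X. A x) = (\<Inter>x\<in>X. vanishing_ideal (A x))"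
  by (auto simp: vanishing_ideal_def)

text \<open>The vanishing ideals of the pieces intersect in the prime \<open>P\<close>, so one of
  them lies in \<open>P\<close>; the other inclusion holds because the pieces lie in the zero
  set.\<close>

lemma vanishing_ideal_UN_eq_prime:
  assumes "is_prime_ideal P" "finite X" "\<And>x. x \<in> X \<Longrightarrow> A x \<subseteq> zero_set P"
    and "vanishing_ideal (\<Union>x\<in>X. A x) = P"
  shows "\<exists>x\<in>X. vanishing_ideal (A x) = P"
proof -
  have "(\<Inter>x\<in>X. vanishing_ideal (A x)) \<subseteq> P"
    using assms(4) by (simp add: vanishing_ideal_UN)
  from prime_ideal_Inter_subset[OF assms(1,2) ideal_vanishing_ideal this]
  obtain x where x: "x \<in> X" "vanishing_ideal (A x) \<subseteq> P"
    by blast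
  then have "vanishing_ideal (A x) = P"
    using subset_vanishing_ideal_zero_set[OF assms(3)] by (intro equalityI)
  then show ?thesis using x(1) by blast
qed

lemma vanishing_ideal_Un_eq_prime:
  assumes "is_prime_ideal P" "A \<union> B \<subseteq> zero_set P" "vanishing_ideal (A \<union> B) = P"
  shows "vanishing_ideal A = P \<or> vanishing_ideal B = P"
  using vanishing_ideal_UN_eq_prime[OF assms(1), of "{A, B}" "\<lambda>x. x"] assms(2,3) by auto

text \<open>Induction on the sign conditions, with the strict inequalities collected in
  \<open>O1\<close>. An equation on a set with vanishing ideal \<open>P\<close> puts
  \<open>g\<close> in \<open>P\<close> and so holds on the whole zero set; a weak inequality splits
  into the two other cases.\<close>

lemma basic_set_dense_open:
  fixes P :: "'n::finite rpoly set"
  assumes "is_prime_ideal P" "open O1" "vanishing_ideal (zero_set P \<inter> O1 \<inter> basic_set cs) = P"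
  shows "\<exists>O'. open O' \<and> vanishing_ideal (zero_set P \<inter> O') = P
    \<and> zero_set P \<inter> O' \<subseteq> zero_set P \<inter> O1 \<inter> basic_set cs"
  using assms(2,3)
proof (induction cs arbitrary: O1)
  case Nil
  then show ?case by (intro exI[of _ O1]) (auto simp: basic_set_def)
next
  case (Cons gc cs)
  obtain g c where gc: "gc = (g, c)" by (cases gc)
  have basic: "basic_set (gc # cs) = {x. holds_cond c (peval g x)} \<inter> basic_set cs"
    by (auto simp: basic_set_def gc)
  let ?Z = "zero_set P"
  let ?pos = "?Z \<inter> (O1 \<inter> {x. peval g x > 0}) \<inter> basic_set cs"
  let ?eq = "?Z \<inter> O1 \<inter> basic_set ((g, Eq) # cs)"
  have eq: "?eq = ?Z \<inter> O1 \<inter> {x. peval g x = 0} \<inter> basic_set cs"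
    by (auto simp: basic_set_def)
  have pos_case: ?case if "vanishing_ideal ?pos = P" "?pos \<subseteq> ?Z \<inter> O1 \<inter> basic_set (gc # cs)"
  proof -
    have "open (O1 \<inter> {x. peval g x > 0})"
      using Cons.prems(1) by (intro open_Int open_Collect_less continuous_intros)
    from Cons.IH[OF this that(1)] that(2) show ?thesis by (meson subset_trans)
  qed
  have eq_case: ?case if "vanishing_ideal ?eq = P" "?eq \<subseteq> ?Z \<inter> O1 \<inter> basic_set (gc # cs)"
  proof -
    have "g \<in> P" using that(1) unfolding eq by (auto simp: vanishing_ideal_def)
    then have "?eq = ?Z \<inter> O1 \<inter> basic_set cs"
      unfolding eq by (auto simp: zero_set_def)
    with Cons.IH[OF Cons.prems(1)] that show ?thesis by (metis subset_trans)
  qed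
  show ?case
  proof (cases c)
    case Gt
    then have "?Z \<inter> O1 \<inter> basic_set (gc # cs) = ?pos"
      unfolding basic by auto
    then show ?thesis using pos_case Cons.prems(2) by auto
  next
    case Eq
    then have "?Z \<inter> O1 \<inter> basic_set (gc # cs) = ?eq"
      unfolding eq basic by auto
    then show ?thesis using eq_case Cons.prems(2) by auto
  next
    case Ge
    then have split: "?Z \<inter> O1 \<inter> basic_set (gc # cs) = ?pos \<union> ?eq"
      unfolding eq basic by auto
    have "vanishing_ideal ?pos = P \<or> vanishing_ideal ?eq = P"
      using Cons.prems(2) unfolding split
      by (intro vanishing_ideal_Un_eq_prime[OF assms(1)]) auto
    then show ?thesis
      using pos_case eq_case split by blast
  qed
qed

lemma semialgebraic_dense_open:
  fixes P :: "'n::finite rpoly set"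
  assumes "is_prime_ideal P" "semialgebraic S" "vanishing_ideal (S \<inter> zero_set P) = P"
  obtains O' where "open O'" "vanishing_ideal (zero_set P \<inter> O') = P" "zero_set P \<inter> O' \<subseteq> S \<inter> zero_set P"
proof -
  obtain L where L: "S = \<Union> (basic_set ` set L)"
    using assms(2) unfolding semialgebraic_def by blast
  then have "S \<inter> zero_set P = (\<Union>cs\<in>set L. zero_set P \<inter> UNIV \<inter> basic_set cs)" by blast
  then obtain cs where cs: "cs \<in> set L" "vanishing_ideal (zero_set P \<inter> UNIV \<inter> basic_set cs) = P"
    using vanishing_ideal_UN_eq_prime[OF assms(1), of "set L" "\<lambda>cs. zero_set P \<inter> UNIV \<inter> basic_set cs"]
      assms(3) by auto
  show ?thesis
    using basic_set_dense_open[OF assms(1) open_UNIV cs(2)] cs(1) L that by blast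
qed

section \<open>Comparison of the dimensions\<close>

lemma dim_top_obtains:
  fixes A :: "(real^'n::finite) set"
  assumes "A \<noteq> {}"
  obtains k M where "dim_top A = int k" "M \<subseteq> A" "M \<noteq> {}" "is_manifold k M"
    "\<And>N d. N \<subseteq> A \<Longrightarrow> N \<noteq> {} \<Longrightarrow> is_manifold d N \<Longrightarrow> d \<le> k"
proof -
  define C where "C = (\<lambda>d. \<exists>M. M \<subseteq> A \<and> M \<noteq> {} \<and> is_manifold d M)"
  \<comment> \<open>This bound, together with single points as manifolds of dimension 0, makes
    \<open>GREATEST\<close> a true maximum.\<close>
  have bound: "d \<le> CARD('n)" if "C d" for d
  proof -
    obtain M where M: "is_manifold d M" "M \<noteq> {}" "M \<subseteq> A"
      using \<open>C d\<close> unfolding C_def by blast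
    obtain F :: "'n set" where "d \<le> card F"
      using manifold_dim_le_indep[OF M(1,2)] by blast
    also have "card F \<le> CARD('n)" by (rule card_mono) auto
    finally show ?thesis .
  qed
  obtain a where a: "a \<in> A" using assms by blast
  have "is_manifold 0 {a}"
    unfolding is_manifold_def
  proof (intro ballI exI conjI)
    show "openin (top_of_set {a}) {a}" by simp
    show "openin (top_of_set (euclid 0)) {\<lambda>_. 0}"
    proof -
      have "euclid 0 = {\<lambda>_. 0}" by (auto simp: euclid_def)
      then show ?thesis by (metis openin_subtopology_self)
    qed
    show "{a} homeomorphic {\<lambda>_::nat. 0::real}"
      unfolding homeomorphic_def homeomorphism_def
      by (intro exI[of _ "\<lambda>_ _. 0"] exI[of _ "\<lambda>_. a"]) auto
  qed auto
  then have "C 0" unfolding C_def using a by (intro exI[of _ "{a}"]) auto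
  then have "C (GREATEST d. C d)"
    using bound by (rule GreatestI_nat)
  moreover have "d \<le> (GREATEST d. C d)" if "C d" for d
    using that bound by (rule Greatest_le_nat)
  moreover have "dim_top A = int (GREATEST d. C d)"
    using assms by (simp add: dim_top_def C_def)
  ultimately show ?thesis
    using that by (metis C_def)
qed

text \<open>If the ideals agree, a manifold of dimension \<open>card F\<close> in the open part
  inside \<open>S\<close> bounds \<open>dim_top\<close> from below, and the prime chain starting at
  a generic prime of a manifold bounds it from above. Conversely, a vanishing ideal larger than
  \<open>P\<close> lets \<open>P\<close> be prepended to such a chain.\<close>

lemma prime_vanishing_ideal_iff_dim:
  fixes P :: "'n::finite rpoly set"
  assumes P: "is_prime_ideal P" and S: "semialgebraic S"
  shows "vanishing_ideal (S \<inter> zero_set P) = P \<longleftrightarrow> dim_top (S \<inter> zero_set P) = krull_dim P"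
proof -
  define A where "A = S \<inter> zero_set P"
  have AP: "P \<subseteq> vanishing_ideal A"
    by (rule subset_vanishing_ideal_zero_set) (simp add: A_def)
  obtain k G where k: "krull_dim P = int k" and G: "indep_mod P G" "k \<le> card G"
    and chain: "\<And>Qs d. prime_chain Qs \<Longrightarrow> length Qs = Suc d \<Longrightarrow> P \<subseteq> hd Qs \<Longrightarrow> d \<le> k"
    using krull_dim_obtains[OF P] by metis
  show ?thesis
  proof
    assume eq: "vanishing_ideal (S \<inter> zero_set P) = P"
    then have "A \<noteq> {}"
      using prime_idealD(3)[OF P] by (auto simp: A_def vanishing_ideal_def)
    then obtain m M where m: "dim_top A = int m" "M \<subseteq> A" "M \<noteq> {}" "is_manifold m M"
      and max: "\<And>N d. N \<subseteq> A \<Longrightarrow> N \<noteq> {} \<Longrightarrow> is_manifold d N \<Longrightarrow> d \<le> m"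
      using dim_top_obtains[of A] by metis
    obtain O' where O': "open O'" "vanishing_ideal (zero_set P \<inter> O') = P" "zero_set P \<inter> O' \<subseteq> A"
      using semialgebraic_dense_open[OF P S eq] unfolding A_def by blast
    obtain F where F: "G \<subseteq> F" "indep_mod P F" "algebraic_over P F"
      using extend_indep_mod[OF P G(1)] by blast
    obtain N where "N \<subseteq> zero_set P \<inter> O'" "N \<noteq> {}" "is_manifold (card F) N"
      using ex_manifold_of_indep_dim[OF P F(2,3) O'(1,2)] by blast
    then have "card F \<le> m"
      using max[of N] O'(3) by blast
    moreover have "card G \<le> card F" using F(1) by (intro card_mono) auto
    ultimately have "k \<le> m" using G(2) by linarith
    moreover have "m \<le> k"
    proof -
      obtain Q F' where Q: "real_prime Q" "vanishing_ideal M \<subseteq> Q" "indep_mod Q F'" "m \<le> card F'"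
        using manifold_dim_le_indep[OF m(4,3)] by blast
      obtain Qs where Qs: "length Qs = Suc (card F')" "prime_chain Qs" "hd Qs = Q"
        using real_prime_chain[OF Q(1,3)] by blast
      have "P \<subseteq> hd Qs"
        using AP vanishing_ideal_antimono[OF m(2)] Q(2) Qs(3) by blast
      then show ?thesis using chain[OF Qs(2,1)] Q(4) by linarith
    qed
    ultimately show "dim_top (S \<inter> zero_set P) = krull_dim P"
      using m(1) k by (simp add: A_def)
  next
    assume eq: "dim_top (S \<inter> zero_set P) = krull_dim P"
    \<comment> \<open>An empty \<open>A\<close> has dimension -1, whereas a prime has Krull
      dimension at least 0.\<close>
    then have "A \<noteq> {}" using k by (auto simp: A_def dim_top_def)
    then obtain m M where m: "dim_top A = int m" "M \<subseteq> A" "M \<noteq> {}" "is_manifold m M"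
      using dim_top_obtains[of A] by metis
    have mk: "m = k" using m(1) k eq by (simp add: A_def)
    obtain Q F where Q: "real_prime Q" "vanishing_ideal M \<subseteq> Q" "indep_mod Q F" "m \<le> card F"
      using manifold_dim_le_indep[OF m(4,3)] by blast
    obtain Qs where Qs: "length Qs = Suc (card F)" "prime_chain Qs" "hd Qs = Q"
      using real_prime_chain[OF Q(1,3)] by blast
    have AQ: "vanishing_ideal A \<subseteq> Q"
      using vanishing_ideal_antimono[OF m(2)] Q(2) by blast
    show "vanishing_ideal (S \<inter> zero_set P) = P"
    proof (rule ccontr)
      assume "vanishing_ideal (S \<inter> zero_set P) \<noteq> P"
      then have strict: "P \<subset> Q" using AP AQ by (auto simp: A_def)
      obtain Rs where Rs: "Qs = Q # Rs" using Qs(1,3) by (cases Qs) auto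
      \<comment> \<open>This chain has \<open>card F + 2\<close> members, so
        \<open>Suc (card F) \<le> k\<close>, against \<open>k = m \<le> card F\<close>.\<close>
      have "prime_chain (P # Qs)"
        using Qs(2) P strict unfolding prime_chain_def Rs by auto
      then have "Suc (card F) \<le> k"
        using chain[of "P # Qs" "Suc (card F)"] Qs(1) by simp
      then show False using Q(4) mk by linarith
    qed
  qed
qed

lemma zero_set_Inter_primes:
  fixes Ps :: "'n::finite rpoly set set"
  assumes "finite Ps" "\<And>P. P \<in> Ps \<Longrightarrow> is_ideal P"
  shows "zero_set (\<Inter>Ps) = (\<Union>P\<in>Ps. zero_set P)"
proof
  show "(\<Union>P\<in>Ps. zero_set P) \<subseteq> zero_set (\<Inter>Ps)"
    by (auto simp: zero_set_def)
  show "zero_set (\<Inter>Ps) \<subseteq> (\<Union>P\<in>Ps. zero_set P)"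
  proof
    fix x assume x: "x \<in> zero_set (\<Inter>Ps)"
    \<comment> \<open>The polynomials vanishing at a point form a prime ideal, so a finite
      intersection of ideals inside it has a member inside it.\<close>
    have "is_prime_ideal (vanishing_ideal {x})"
      unfolding is_prime_ideal_def
    proof (intro conjI ideal_vanishing_ideal)
      have "1 \<notin> vanishing_ideal {x}" by (simp add: vanishing_ideal_def)
      then show "vanishing_ideal {x} \<noteq> UNIV" by blast
    qed (simp add: vanishing_ideal_def)
    moreover have "(\<Inter>P\<in>Ps. P) \<subseteq> vanishing_ideal {x}"
      using x by (auto simp: zero_set_def vanishing_ideal_def)
    ultimately obtain P where "P \<in> Ps" "P \<subseteq> vanishing_ideal {x}"
      using prime_ideal_Inter_subset[of _ Ps "\<lambda>P. P"] assms by blast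
    then show "x \<in> (\<Union>P\<in>Ps. zero_set P)"
      by (auto simp: zero_set_def vanishing_ideal_def)
  qed
qed

text \<open>The vanishing ideal of a union is the intersection of the vanishing ideals. If it equals
  \<open>I\<close>, primality of \<open>P\<close> puts the one belonging to some \<open>R\<close>
  into \<open>P\<close>, and irredundance forces \<open>R = P\<close>.\<close>

lemma vanishing_ideal_eq_iff_components:
  fixes S :: "(real^'n::finite) set"
  assumes "prime_decomposition I Ps"
  shows "vanishing_ideal (S \<inter> zero_set I) = I \<longleftrightarrow> (\<forall>P\<in>Ps. vanishing_ideal (S \<inter> zero_set P) = P)"
proof -
  have fin: "finite Ps" and prime: "\<And>P. P \<in> Ps \<Longrightarrow> is_prime_ideal P" and I: "I = \<Inter>Ps"
    and irr: "\<And>P. P \<in> Ps \<Longrightarrow> \<Inter>(Ps - {P}) \<noteq> I"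
    using assms by (auto simp: prime_decomposition_def)
  have "zero_set I = (\<Union>P\<in>Ps. zero_set P)"
    unfolding I using prime_idealD(1)[OF prime] by (rule zero_set_Inter_primes[OF fin])
  then have "S \<inter> zero_set I = (\<Union>P\<in>Ps. S \<inter> zero_set P)" by blast
  then have van: "vanishing_ideal (S \<inter> zero_set I) = (\<Inter>P\<in>Ps. vanishing_ideal (S \<inter> zero_set P))"
    by (simp only: vanishing_ideal_UN)
  have sub: "P \<subseteq> vanishing_ideal (S \<inter> zero_set P)" for P
    by (rule subset_vanishing_ideal_zero_set) simp
  show ?thesis
  proof
    assume eq: "vanishing_ideal (S \<inter> zero_set I) = I"
    show "\<forall>P\<in>Ps. vanishing_ideal (S \<inter> zero_set P) = P"
    proof
      fix P assume P: "P \<in> Ps"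
      have "I \<subseteq> P" unfolding I using P by (rule Inter_lower)
      then have "(\<Inter>R\<in>Ps. vanishing_ideal (S \<inter> zero_set R)) \<subseteq> P"
        by (simp only: van[symmetric] eq)
      from prime_ideal_Inter_subset[OF prime[OF P] fin ideal_vanishing_ideal this]
      obtain R where R: "R \<in> Ps" "vanishing_ideal (S \<inter> zero_set R) \<subseteq> P"
        by blast
      then have "R \<subseteq> P" using sub by blast
      have "R = P"
      proof (rule ccontr)
        assume "R \<noteq> P"
        then have "\<Inter>(Ps - {P}) \<subseteq> P" using R(1) \<open>R \<subseteq> P\<close> by blast
        then have "\<Inter>(Ps - {P}) = I" unfolding I by blast
        then show False using irr[OF P] by blast
      qed
      then show "vanishing_ideal (S \<inter> zero_set P) = P" using R(2) sub by blast
    qed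
  next
    assume eq: "\<forall>P\<in>Ps. vanishing_ideal (S \<inter> zero_set P) = P"
    have "(\<Inter>P\<in>Ps. vanishing_ideal (S \<inter> zero_set P)) = (\<Inter>P\<in>Ps. P)"
      using eq by (intro INF_cong) simp_all
    then show "vanishing_ideal (S \<inter> zero_set I) = I"
      by (simp only: van) (simp add: I)
  qed
qed

theorem theorem2p2:
  fixes S :: "(real^'n::finite) set" and I :: "'n rpoly set" and Ps :: "'n rpoly set set"
  assumes "semialgebraic S"
    and "is_ideal I"
    and "prime_decomposition I Ps"
  shows "vanishing_ideal (S \<inter> zero_set I) = I
         \<longleftrightarrow> (\<forall>P\<in>Ps. dim_top (S \<inter> zero_set P) = krull_dim P)"
  unfolding vanishing_ideal_eq_iff_components[OF assms(3)]
proof (rule ball_cong[OF refl])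
  fix P assume "P \<in> Ps"
  then have "is_prime_ideal P"
    using assms(3) by (simp add: prime_decomposition_def)
  then show "vanishing_ideal (S \<inter> zero_set P) = P \<longleftrightarrow> dim_top (S \<inter> zero_set P) = krull_dim P"
    using assms(1) by (rule prime_vanishing_ideal_iff_dim)
qed

end
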